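(* Every finite simple biconnected outerplanar graph $G$ with maximum degree $\Delta = 6$ satisfies $\chi(G^2) = 7$.
   Context: $G^2$ is the graph on $V(G)$ in which two distinct vertices are adjacent iff their distance in $G$ is 1 or 2; $\chi$ is the chromatic number. *)

theory Defs
  imports "HOL-Analysis.Analysis" "Graph_Theory.Graph_Theory"
begin

text \<open>
  Finite simple graphs are the \<^locale>\<open>pair_graph\<close>s of the graph library: finite, loop-free,
  symmetric digraphs whose arcs are pairs of vertices. An undirected edge corresponds to two
  opposite arcs, so the out-degree of a vertex is its degree.
\<close>

definition edges :: "'a pair_pre_digraph \<Rightarrow> 'a set set" where
  "edges G = {{u, v} | u v. (u, v) \<in> parcs G}"

definition max_degree :: "'a pair_pre_digraph \<Rightarrow> nat" where
  "max_degree G = Max (out_degree (with_proj G) ` pverts G)"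

definition biconnected :: "'a pair_pre_digraph \<Rightarrow> bool" where
  "biconnected G \<longleftrightarrow>
     Digraph_Component.connected (with_proj G) \<and>
     (\<forall>v \<in> pverts G. Digraph_Component.connected (pre_digraph.del_vert (with_proj G) v))"

text \<open>A drawing in the plane: \<open>p\<close> places the vertices, \<open>\<gamma> e\<close> is a simple arc representing
  the edge \<open>e\<close>; arcs contain no vertices but their ends and meet only in common ends.\<close>

definition plane_drawing ::
    "'a pair_pre_digraph \<Rightarrow> ('a \<Rightarrow> complex) \<Rightarrow> ('a set \<Rightarrow> real \<Rightarrow> complex) \<Rightarrow> bool" where
  "plane_drawing G p \<gamma> \<longleftrightarrow>
     inj_on p (pverts G) \<and>
     (\<forall>e \<in> edges G. Path_Connected.arc (\<gamma> e) \<and> {pathstart (\<gamma> e), pathfinish (\<gamma> e)} = p ` e) \<and>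
     (\<forall>e \<in> edges G. \<forall>w \<in> pverts G. p w \<in> path_image (\<gamma> e) \<longrightarrow> w \<in> e) \<and>
     (\<forall>e \<in> edges G. \<forall>f \<in> edges G. e \<noteq> f \<longrightarrow>
        path_image (\<gamma> e) \<inter> path_image (\<gamma> f) \<subseteq> p ` (e \<inter> f))"

definition drawing_image ::
    "'a pair_pre_digraph \<Rightarrow> ('a \<Rightarrow> complex) \<Rightarrow> ('a set \<Rightarrow> real \<Rightarrow> complex) \<Rightarrow> complex set" where
  "drawing_image G p \<gamma> = p ` pverts G \<union> (\<Union>e \<in> edges G. path_image (\<gamma> e))"

text \<open>For a finite graph the drawing is compact, so \<^const>\<open>outside\<close> yields the unique unbounded
  face of the drawing.\<close>

definition outerplanar :: "'a pair_pre_digraph \<Rightarrow> bool" where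
  "outerplanar G \<longleftrightarrow>
     (\<exists>p \<gamma>. plane_drawing G p \<gamma> \<and>
            (\<forall>v \<in> pverts G. p v \<in> frontier (outside (drawing_image G p \<gamma>))))"

text \<open>With unit weights, \<^const>\<open>wf_digraph.\<mu>\<close> is the graph distance.\<close>

definition graph_dist :: "'a pair_pre_digraph \<Rightarrow> 'a \<Rightarrow> 'a \<Rightarrow> ereal" where
  "graph_dist G u v = wf_digraph.\<mu> (with_proj G) (\<lambda>_. 1) u v"

definition graph_square :: "'a pair_pre_digraph \<Rightarrow> 'a pair_pre_digraph" where
  "graph_square G =
     \<lparr> pverts = pverts G,
       parcs = {(u, v). u \<in> pverts G \<and> v \<in> pverts G \<and> u \<noteq> v \<and>
                        (graph_dist G u v = 1 \<or> graph_dist G u v = 2)} \<rparr>"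

definition proper_coloring :: "'a pair_pre_digraph \<Rightarrow> nat \<Rightarrow> ('a \<Rightarrow> nat) \<Rightarrow> bool" where
  "proper_coloring G k c \<longleftrightarrow>
     (\<forall>v \<in> pverts G. c v < k) \<and> (\<forall>(u, v) \<in> parcs G. c u \<noteq> c v)"

definition chromatic_number :: "'a pair_pre_digraph \<Rightarrow> nat" where
  "chromatic_number G = (LEAST k. \<exists>c. proper_coloring G k c)"

end

theory Submission
  imports Defs
begin

text \<open>
  Three arcs with common ends that are otherwise disjoint form a theta curve, and one of them runs
  inside the closed curve formed by the other two. Hence in an outerplanar graph no two vertices are
  joined by three internally disjoint paths that all have interior vertices. In a biconnected graph
  this forces a longest cycle to be Hamiltonian, because an ear attached to it would either lengthen
  it or complete a theta, and it forces the chords to be pairwise noncrossing.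

  Number the vertices \<open>0, \<dots>, n\<close> along the Hamiltonian cycle and call an interval \<open>[l, r]\<close>
  together with the colours \<open>p\<close>, \<open>q\<close> of its ends and the sets \<open>A\<close>, \<open>B\<close> of colours of their
  neighbours inside the interval a state. Only the state matters for the rest of the graph. By
  induction on the length of the interval, every state in which \<open>A\<close> and \<open>B\<close> meet is realised by a
  7-colouring of the square, apart from a few exceptions for very small \<open>A\<close> and \<open>B\<close>. In the
  induction step \<open>[l, r]\<close> is cut at the least neighbour \<open>w\<close> of \<open>r\<close> in its interior, and one has to
  choose the colour of \<open>w\<close> and those of its neighbours on either side. Whether this is possible
  depends only on the sizes of the Venn regions of \<open>A\<close> and \<open>B\<close>, so it is a finite check.
\<close>

subsection \<open>Theta curves\<close>

lemma connected_subset_inside_or_outside: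
  fixes S T :: "'a::euclidean_space set"
  assumes "Topological_Spaces.connected S" "closed T" "S \<inter> T = {}"
  shows "S \<subseteq> inside T \<or> S \<subseteq> outside T"
proof -
  have "S \<subseteq> inside T \<union> outside T"
    using assms(3) by (auto simp: inside_Un_outside)
  then show ?thesis
    using connectedD[OF assms(1), of "inside T" "outside T"] open_inside[OF assms(2)]
      open_outside[OF assms(2)] inside_Int_outside[of T] by blast
qed

lemma theta_inside:
  fixes g1 g2 g3 :: "real \<Rightarrow> complex"
  assumes arcs: "arc g1" "arc g2" "arc g3"
    and start: "pathstart g1 = a" "pathstart g2 = a" "pathstart g3 = a"
    and finish: "pathfinish g1 = b" "pathfinish g2 = b" "pathfinish g3 = b"
    and int: "path_image g1 \<inter> path_image g2 = {a,b}" "path_image g1 \<inter> path_image g3 = {a,b}"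
      "path_image g2 \<inter> path_image g3 = {a,b}"
  shows "path_image g1 - {a,b} \<subseteq> inside (path_image g2 \<union> path_image g3) \<or>
         path_image g2 - {a,b} \<subseteq> inside (path_image g1 \<union> path_image g3) \<or>
         path_image g3 - {a,b} \<subseteq> inside (path_image g1 \<union> path_image g2)"
proof (rule ccontr)
  \<comment> \<open>Otherwise the insides of the three closed curves are disjoint. The closures of two of them meet in
    a single arc, so by Janiszewski's theorem the complement of their union is connected; but the third
    inside is a bounded part of it that is open and closed.\<close>
  assume neg: "\<not> ?thesis"
  define C1 C2 C3 where "C1 = path_image g1" and "C2 = path_image g2" and "C3 = path_image g3"
  note C = C1_def C2_def C3_def
  have int': "C1 \<inter> C2 = {a,b}" "C1 \<inter> C3 = {a,b}" "C2 \<inter> C3 = {a,b}"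
    using int by (simp_all add: C)
  have jordan: "inside (path_image g \<union> path_image h) \<noteq> {} \<and>
      open (inside (path_image g \<union> path_image h)) \<and>
      Topological_Spaces.connected (inside (path_image g \<union> path_image h)) \<and>
      Topological_Spaces.connected (outside (path_image g \<union> path_image h)) \<and>
      bounded (inside (path_image g \<union> path_image h)) \<and>
      frontier (inside (path_image g \<union> path_image h)) = path_image g \<union> path_image h"
    if "arc g" "arc h" "pathstart g = a" "pathstart h = a" "pathfinish g = b" "pathfinish h = b"
      "path_image g \<inter> path_image h = {a,b}" for g h :: "real \<Rightarrow> complex"
  proof -
    have "simple_path (g +++ reversepath h)"
      using that by (intro simple_path_join_loop) (auto simp: arc_reversepath)
    then show ?thesis
      using Jordan_inside_outside[of "g +++ reversepath h"] that
      by (simp add: path_image_join)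
  qed
  note J12 = jordan[OF arcs(1,2) start(1,2) finish(1,2) int(1), folded C]
  note J13 = jordan[OF arcs(1,3) start(1,3) finish(1,3) int(2), folded C]
  note J23 = jordan[OF arcs(2,3) start(2,3) finish(2,3) int(3), folded C]
  have closed: "closed C1" "closed C2" "closed C3"
    using arcs by (auto simp: C closed_arc_image)
  have endless: "Topological_Spaces.connected (path_image g - {a,b})" "path_image g - {a,b} \<noteq> {}"
    if "arc g" "pathstart g = a" "pathfinish g = b" for g :: "real \<Rightarrow> complex"
    using that connected_simple_path_endless[of g] simple_path_endless[of g]
      nonempty_simple_path_endless[of g] arc_imp_simple_path[of g] by auto
  note E1 = endless[OF arcs(1) start(1) finish(1), folded C]
  note E2 = endless[OF arcs(2) start(2) finish(2), folded C]
  note E3 = endless[OF arcs(3) start(3) finish(3), folded C]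
  \<comment> \<open>By \<open>neg\<close> no open arc lies inside the curve formed by the other two;
    being connected and disjoint from that curve, it lies outside.\<close>
  have out: "C1 \<inter> inside (C2 \<union> C3) = {}" "C2 \<inter> inside (C1 \<union> C3) = {}" "C3 \<inter> inside (C1 \<union> C2) = {}"
  proof -
    have *: "C \<inter> inside (D \<union> E) = {}"
      if "Topological_Spaces.connected (C - {a,b})" "closed D" "closed E" "C \<inter> D = {a,b}" "C \<inter> E = {a,b}"
        "\<not> C - {a,b} \<subseteq> inside (D \<union> E)" for C D E :: "complex set"
    proof -
      have "C - {a,b} \<subseteq> outside (D \<union> E)"
        using connected_subset_inside_or_outside[of "C - {a,b}" "D \<union> E"] that by blast
      moreover have "{a,b} \<inter> inside (D \<union> E) = {}"
        using that(4) inside_no_overlap[of "D \<union> E"] by blast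
      ultimately show ?thesis
        using inside_Int_outside[of "D \<union> E"] by blast
    qed
    show "C1 \<inter> inside (C2 \<union> C3) = {}"
      using *[of C1 C2 C3] E1 closed int' neg by (simp add: C)
    show "C2 \<inter> inside (C1 \<union> C3) = {}"
      using *[of C2 C1 C3] E2 closed int' neg by (simp add: C Int_commute)
    show "C3 \<inter> inside (C1 \<union> C2) = {}"
      using *[of C3 C1 C2] E3 closed int' neg by (simp add: C Int_commute)
  qed
  \<comment> \<open>Each inside is connected and misses the other curve, so it lies inside or
    outside that curve. If either lies outside, the two are disjoint; otherwise they contain each
    other, which is impossible because their frontiers differ.\<close>
  have disj: "inside (D \<union> E) \<inter> inside (D \<union> F) = {}"
    if "closed D" "closed E" "closed F" "F \<inter> inside (D \<union> E) = {}" "E \<inter> inside (D \<union> F) = {}"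
      "Topological_Spaces.connected (inside (D \<union> E))" "Topological_Spaces.connected (inside (D \<union> F))"
      "frontier (inside (D \<union> E)) = D \<union> E" "frontier (inside (D \<union> F)) = D \<union> F"
      "D \<union> E \<noteq> D \<union> F" for D E F :: "complex set"
  proof -
    have 1: "inside (D \<union> E) \<inter> (D \<union> F) = {}" "inside (D \<union> F) \<inter> (D \<union> E) = {}"
      using that(4,5) inside_no_overlap[of "D \<union> E"] inside_no_overlap[of "D \<union> F"] by blast+
    have 2: "inside (D \<union> E) \<subseteq> inside (D \<union> F) \<or> inside (D \<union> E) \<subseteq> outside (D \<union> F)"
      by (rule connected_subset_inside_or_outside) (use that 1 in auto)
    have 3: "inside (D \<union> F) \<subseteq> inside (D \<union> E) \<or> inside (D \<union> F) \<subseteq> outside (D \<union> E)"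
      by (rule connected_subset_inside_or_outside) (use that 1 in auto)
    have 4: "inside (D \<union> E) \<noteq> inside (D \<union> F)"
      using that(8,9,10) by metis
    show ?thesis
      using 2 3 4 inside_Int_outside[of "D \<union> E"] inside_Int_outside[of "D \<union> F"] by blast
  qed
  have ne: "C1 \<union> C2 \<noteq> C1 \<union> C3" "C2 \<union> C1 \<noteq> C2 \<union> C3" "C3 \<union> C1 \<noteq> C3 \<union> C2"
    using E1(2) E2(2) E3(2) int' by blast+
  have d12_13: "inside (C1 \<union> C2) \<inter> inside (C1 \<union> C3) = {}"
    using disj[of C1 C2 C3] closed out J12 J13 ne by simp
  have d12_23: "inside (C1 \<union> C2) \<inter> inside (C2 \<union> C3) = {}"
    using disj[of C2 C1 C3] closed out J12 J23 ne by (simp add: Un_commute)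
  have d13_23: "inside (C1 \<union> C3) \<inter> inside (C2 \<union> C3) = {}"
    using disj[of C3 C1 C2] closed out J13 J23 ne by (simp add: Un_commute)
  define S T where "S = closure (inside (C1 \<union> C2))" and "T = closure (inside (C1 \<union> C3))"
  have S: "S = inside (C1 \<union> C2) \<union> (C1 \<union> C2)" and T: "T = inside (C1 \<union> C3) \<union> (C1 \<union> C3)"
    using J12 J13 by (simp_all add: S_def T_def closure_Un_frontier)
  have "Topological_Spaces.connected (- (S \<union> T))"
  proof (rule Janiszewski_connected)
    show "compact S" "closed T"
      using J12 by (simp_all add: S_def T_def)
    have "x \<in> C1" if "x \<in> S" "x \<in> T" for x
    proof (rule ccontr)
      assume "x \<notin> C1"
      then have "x \<in> inside (C1 \<union> C2) \<or> x \<in> C2" "x \<in> inside (C1 \<union> C3) \<or> x \<in> C3"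
        using that by (auto simp: S T)
      moreover have "\<not> (x \<in> C2 \<and> x \<in> C3)"
        using int' \<open>x \<notin> C1\<close> by auto
      ultimately show False
        using d12_13 out by (auto simp: disjoint_iff)
    qed
    moreover have "C1 \<subseteq> S" "C1 \<subseteq> T"
      by (auto simp: S T)
    ultimately have "S \<inter> T = C1"
      by blast
    then show "Topological_Spaces.connected (S \<inter> T)"
      using arcs(1) by (simp add: C1_def connected_arc_image)
    have "- S = outside (C1 \<union> C2)" "- T = outside (C1 \<union> C3)"
      unfolding S T by (auto simp: outside_inside)
    then show "Topological_Spaces.connected (- S)" "Topological_Spaces.connected (- T)"
      using J12 J13 by auto
  qed
  moreover have "- (S \<union> T) \<inter> (C2 \<union> C3) = {}"
    unfolding S T by blast
  ultimately have "- (S \<union> T) \<subseteq> inside (C2 \<union> C3) \<or> - (S \<union> T) \<subseteq> outside (C2 \<union> C3)"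
    using closed by (intro connected_subset_inside_or_outside) auto
  moreover have "inside (C2 \<union> C3) \<subseteq> - (S \<union> T)"
  proof
    fix x assume x: "x \<in> inside (C2 \<union> C3)"
    then have "x \<notin> C2" "x \<notin> C3"
      using inside_no_overlap[of "C2 \<union> C3"] by blast+
    with x show "x \<in> - (S \<union> T)"
      using d12_23 d13_23 out by (auto simp: S T disjoint_iff)
  qed
  ultimately have "- (S \<union> T) \<subseteq> inside (C2 \<union> C3)"
    using J23 inside_Int_outside[of "C2 \<union> C3"] by blast
  then have "bounded (- (S \<union> T))"
    using J23 bounded_subset by blast
  moreover have "bounded (S \<union> T)"
    using J12 J13 by (simp add: S_def T_def bounded_closure)
  ultimately have "bounded (UNIV :: complex set)"
    by (metis bounded_Un sup_compl_top)
  then show False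
    by simp
qed

subsection \<open>Hamiltonian cycles in theta-free graphs\<close>

lemma rtranclp_imp_distinct_path:
  assumes "R\<^sup>*\<^sup>* x y"
  shows "\<exists>xs. xs \<noteq> [] \<and> distinct xs \<and> successively R xs \<and> hd xs = x \<and> last xs = y"
  using assms
proof (induction rule: rtranclp_induct)
  case base
  show ?case
    by (intro exI[of _ "[x]"]) simp
next
  case (step y z)
  then obtain xs where xs: "xs \<noteq> []" "distinct xs" "successively R xs" "hd xs = x" "last xs = y"
    by blast
  show ?case
  proof (cases "z \<in> set xs")
    case True
    then obtain ys zs where "xs = ys @ z # zs"
      by (auto dest: split_list)
    with xs show ?thesis
      by (intro exI[of _ "ys @ [z]"]) (auto simp: successively_append_iff hd_append)
  next
    case False
    with xs step.hyps show ?thesis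
      by (intro exI[of _ "xs @ [z]"]) (auto simp: successively_append_iff)
  qed
qed

lemma rtranclp_crossing:
  assumes "R\<^sup>*\<^sup>* x y" "x \<in> S" "y \<notin> S"
  shows "\<exists>u v. u \<in> S \<and> v \<notin> S \<and> R u v"
  using assms by (induction rule: rtranclp_induct) auto

definition vertex_cycle :: "('a \<Rightarrow> 'a \<Rightarrow> bool) \<Rightarrow> 'a list \<Rightarrow> bool" where
  "vertex_cycle E xs \<longleftrightarrow> 3 \<le> length xs \<and> distinct xs \<and> successively E xs \<and> E (last xs) (hd xs)"

text \<open>The lists \<open>P\<close>, \<open>Q\<close>, \<open>R\<close> hold the interior
  vertices of the three paths. Because all of them are nonempty, a cycle with a chord does not count
  as a theta.\<close>

definition theta_free :: "('a \<Rightarrow> 'a \<Rightarrow> bool) \<Rightarrow> bool" where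
  "theta_free E \<longleftrightarrow> (\<forall>a b P Q R. P \<noteq> [] \<and> Q \<noteq> [] \<and> R \<noteq> [] \<and> distinct (a # b # P @ Q @ R) \<longrightarrow>
     \<not> (successively E (a # P @ [b]) \<and> successively E (a # Q @ [b]) \<and> successively E (a # R @ [b])))"

lemma successively_Cons_snoc:
  "P \<noteq> [] \<Longrightarrow> successively E (a # P @ [b]) \<longleftrightarrow> E a (hd P) \<and> successively E P \<and> E (last P) b"
  by (auto simp: successively_append_iff successively_Cons)

lemma vertex_cycle_rotate: "vertex_cycle E (xs @ ys) \<Longrightarrow> vertex_cycle E (ys @ xs)"
  by (cases "xs = []"; cases "ys = []") (auto simp: vertex_cycle_def successively_append_iff)

lemma vertex_cycle_subset:
  assumes "vertex_cycle E xs" and EV: "\<And>u v. E u v \<Longrightarrow> u \<in> V \<and> v \<in> V"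
  shows "set xs \<subseteq> V"
proof
  fix v assume "v \<in> set xs"
  then obtain ys zs where "xs = ys @ v # zs"
    by (auto dest: split_list)
  with vertex_cycle_rotate[of E ys "v # zs"] assms(1) have "vertex_cycle E (v # zs @ ys)"
    by simp
  then show "v \<in> V"
    by (cases "zs @ ys") (use EV in \<open>auto simp: vertex_cycle_def\<close>)
qed

lemma successively_rev_sym:
  assumes "symp E"
  shows "successively E (rev xs) \<longleftrightarrow> successively E xs"
proof -
  have "(\<lambda>x y. E y x) = E"
    using assms by (auto simp: symp_def fun_eq_iff)
  from arg_cong[OF this, of "\<lambda>R. successively R xs"] show ?thesis
    by (simp only: successively_rev)
qed

text \<open>An edge leaves the cycle at some \<open>a\<close>. Without \<open>a\<close> the graph is
  still connected, so the excursion returns to the cycle at a second vertex \<open>b\<close>. This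
  ear either yields a longer cycle or completes a theta.\<close>

lemma longest_cycle_spanning:
  assumes sym: "symp E" and EV: "\<And>u v. E u v \<Longrightarrow> u \<in> V \<and> v \<in> V"
    and conn: "\<And>u v. u \<in> V \<Longrightarrow> v \<in> V \<Longrightarrow> E\<^sup>*\<^sup>* u v"
    and biconn: "\<And>a u v. a \<in> V \<Longrightarrow> u \<in> V - {a} \<Longrightarrow> v \<in> V - {a} \<Longrightarrow> (\<lambda>x y. E x y \<and> x \<noteq> a \<and> y \<noteq> a)\<^sup>*\<^sup>* u v"
    and theta: "theta_free E"
    and cyc: "vertex_cycle E xs" and longest: "\<And>ys. vertex_cycle E ys \<Longrightarrow> length ys \<le> length xs"
  shows "set xs = V"
proof (rule ccontr)
  assume neq: "set xs \<noteq> V"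
  have xs: "xs \<noteq> []" "distinct xs" "3 \<le> length xs"
    using cyc by (auto simp: vertex_cycle_def)
  have inV: "set xs \<subseteq> V"
    using vertex_cycle_subset[OF cyc EV] .
  with neq obtain y where y: "y \<in> V" "y \<notin> set xs"
    by blast
  have "hd xs \<in> set xs"
    using xs by simp
  with y inV obtain a v where av: "a \<in> set xs" "v \<notin> set xs" "E a v"
    using rtranclp_crossing[OF conn[of "hd xs" y], of "set xs"] by blast
  have "\<exists>b0 \<in> set xs. b0 \<noteq> a"
  proof (rule ccontr)
    assume "\<not> ?thesis"
    then have "set xs \<subseteq> {a}"
      by auto
    then have "card (set xs) \<le> card {a}"
      by (intro card_mono) auto
    then show False
      using xs distinct_card[of xs] by simp
  qed
  then obtain b0 where b0: "b0 \<in> set xs" "b0 \<noteq> a"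
    by blast
  define R where "R = (\<lambda>x y. E x y \<and> x \<noteq> a \<and> y \<noteq> a)"
  have "R\<^sup>*\<^sup>* v b0"
    unfolding R_def using av b0 inV EV by (intro biconn) auto
  from rtranclp_imp_distinct_path[OF this] obtain ys where ys: "ys \<noteq> []" "distinct ys" "successively R ys" "hd ys = v" "last ys = b0"
    by blast
  \<comment> \<open>The part of the path before its first return to the cycle, that is, the interior
    of the ear. It is nonempty because it starts with \<open>v\<close>.\<close>
  define zs where "zs = takeWhile (\<lambda>u. u \<notin> set xs) ys"
  have dne: "dropWhile (\<lambda>u. u \<notin> set xs) ys \<noteq> []"
    using ys b0 by (metis dropWhile_eq_Nil_conv last_in_set)
  then obtain b rest where drop: "dropWhile (\<lambda>u. u \<notin> set xs) ys = b # rest"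
    by (cases "dropWhile (\<lambda>u. u \<notin> set xs) ys") auto
  have b: "b \<in> set xs"
    using hd_dropWhile[OF dne] drop by simp
  have ysplit: "ys = zs @ b # rest"
    using takeWhile_dropWhile_id[of "\<lambda>u. u \<notin> set xs" ys] drop by (simp add: zs_def)
  have zne: "zs \<noteq> []"
    using ysplit ys(4) b av(2) by (cases zs) auto
  have zs_out: "set zs \<inter> set xs = {}"
    by (auto simp: zs_def dest: set_takeWhileD)
  have "successively R (zs @ [b])"
    using ys(3) ysplit by (auto simp: successively_append_iff)
  then have "successively E (zs @ [b])" and Rlast: "R (last zs) b"
    using zne by (auto simp: R_def successively_append_iff elim: successively_mono)
  then have zs: "successively E zs" "E (last zs) b" "E a (hd zs)" "b \<noteq> a" "distinct zs"
    using zne av(3) ys ysplit by (auto simp: successively_append_iff R_def)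
  obtain xs1 xs2 where "xs = xs1 @ a # xs2"
    using av(1) by (auto dest: split_list)
  then have cyc': "vertex_cycle E (a # xs2 @ xs1)" and len: "length xs = length (a # xs2 @ xs1)"
    and set_xs: "set xs = set (a # xs2 @ xs1)"
    using vertex_cycle_rotate[of E xs1 "a # xs2"] cyc by auto
  have "b \<in> set (xs2 @ xs1)"
    using b zs(4) set_xs by auto
  then obtain P Q where PQ: "xs2 @ xs1 = P @ b # Q"
    by (meson split_list)
  note cyc' = cyc'[unfolded PQ] and len = len[unfolded PQ] and set_xs = set_xs[unfolded PQ]
  have dist: "distinct (a # P @ b # Q)" "set zs \<inter> set (a # P @ b # Q) = {}"
    using cyc' zs_out set_xs by (auto simp: vertex_cycle_def)
  have symE: "E u w \<Longrightarrow> E w u" for u w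
    using sym by (auto simp: symp_def)
  note rev = successively_rev_sym[OF sym]
  \<comment> \<open>If \<open>P\<close> or \<open>Q\<close> is empty, \<open>a\<close> and
    \<open>b\<close> are consecutive on the cycle and the ear can replace the edge between them.
    Otherwise the two sides of the cycle and the ear form a theta.\<close>
  consider "P = []" | "Q = []" | "P \<noteq> []" "Q \<noteq> []"
    by blast
  then show False
  proof cases
    case 1
    then have "vertex_cycle E (a # zs @ b # Q)"
      using cyc' zne zs dist
      by (auto simp: vertex_cycle_def successively_append_iff successively_Cons)
    from longest[OF this] show False
      using len 1 zne by simp
  next
    case 2
    have "vertex_cycle E (a # P @ b # rev zs)"
      using cyc' zne zs dist 2 sym
      by (auto simp: vertex_cycle_def successively_append_iff successively_Cons rev hd_append
          hd_rev last_rev intro: symE simp del: successively_rev)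
    from longest[OF this] show False
      using len 2 zne by simp
  next
    case 3
    have "successively E (a # P @ [b])"
      using cyc' 3 by (auto simp: vertex_cycle_def successively_append_iff successively_Cons)
    moreover have "successively E (a # rev Q @ [b])"
      using cyc' 3 sym
      by (auto simp: vertex_cycle_def successively_append_iff successively_Cons rev hd_append
          hd_rev last_rev intro: symE simp del: successively_rev)
    moreover have "successively E (a # zs @ [b])"
      using zs zne by (simp add: successively_Cons_snoc)
    moreover have "distinct (a # b # P @ rev Q @ zs)"
      using dist zs by auto
    ultimately show False
      using theta 3 zne unfolding theta_free_def by (metis rev_is_Nil_conv)
  qed
qed

text \<open>A path from \<open>u\<close> to \<open>v\<close> that avoids \<open>a\<close> closes up
  through \<open>a\<close> to a first cycle. Lengths of cycles are bounded by \<open>card V\<close>,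
  so a longest one exists.\<close>

lemma exists_spanning_cycle:
  assumes sym: "symp E" and fin: "finite V" and EV: "\<And>u v. E u v \<Longrightarrow> u \<in> V \<and> v \<in> V"
    and irrefl: "\<And>v. \<not> E v v"
    and conn: "\<And>u v. u \<in> V \<Longrightarrow> v \<in> V \<Longrightarrow> E\<^sup>*\<^sup>* u v"
    and biconn: "\<And>a u v. a \<in> V \<Longrightarrow> u \<in> V - {a} \<Longrightarrow> v \<in> V - {a} \<Longrightarrow> (\<lambda>x y. E x y \<and> x \<noteq> a \<and> y \<noteq> a)\<^sup>*\<^sup>* u v"
    and theta: "theta_free E"
    and deg: "E a u" "E a v" "u \<noteq> v"
  shows "\<exists>xs. vertex_cycle E xs \<and> set xs = V"
proof -
  have ne: "u \<noteq> a" "v \<noteq> a"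
    using deg irrefl by auto
  have inV: "a \<in> V" "u \<in> V" "v \<in> V"
    using deg EV by auto
  obtain ys where ys: "ys \<noteq> []" "distinct ys" "successively (\<lambda>x y. E x y \<and> x \<noteq> a \<and> y \<noteq> a) ys" "hd ys = u" "last ys = v"
    using rtranclp_imp_distinct_path[OF biconn[of a u v]] inV ne by auto
  obtain y z zs where yz: "ys = y # z # zs"
    using ys deg(3) by (cases ys rule: remdups_adj.cases) auto
  have sE: "successively E ys"
    using ys(3) by (auto elim: successively_mono)
  have "a \<notin> set ys"
  proof
    assume "a \<in> set ys"
    then obtain us vs where us: "ys = us @ a # vs"
      by (auto dest: split_list)
    show False
      using ys(3,4) ne us by (cases us) (auto simp: successively_append_iff successively_Cons)
  qed
  then have cyc: "vertex_cycle E (a # ys)"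
    using ys sE yz deg sym by (auto simp: vertex_cycle_def successively_Cons symp_def)
  have setV: "set xs \<subseteq> V" if "vertex_cycle E xs" for xs
    using vertex_cycle_subset[OF that EV] .
  have "length xs < Suc (card V)" if "vertex_cycle E xs" for xs
    using card_mono[OF fin setV[OF that]] that distinct_card[of xs] by (simp add: vertex_cycle_def)
  then obtain xs where "vertex_cycle E xs" "\<And>ys. vertex_cycle E ys \<Longrightarrow> length ys \<le> length xs"
    using ex_has_greatest_nat[of "vertex_cycle E" "a # ys" length "Suc (card V)"] cyc by blast
  then show ?thesis
    using longest_cycle_spanning[of E V xs] sym EV conn biconn theta by blast
qed

text \<open>Three paths lead from \<open>a\<close> to \<open>b\<close>: along \<open>A\<close>, over
  the chord to \<open>c\<close> and back through \<open>B\<close>, and backwards through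
  \<open>D\<close> to \<open>d\<close> and over the other chord. The last two always have interior
  vertices, so \<open>A\<close> cannot have any.\<close>

lemma crossing_chords_theta_aux:
  assumes sym: "symp E" and theta: "theta_free E"
    and cyc: "vertex_cycle E (a # A @ b # B @ c # C @ d # D)" and chords: "E a c" "E b d"
  shows "A = []"
proof (rule ccontr)
  assume A: "A \<noteq> []"
  have symE: "E u w \<Longrightarrow> E w u" for u w
    using sym by (auto simp: symp_def)
  note rev = successively_rev_sym[OF sym]
  have "successively E (a # A @ [b])"
    using cyc A by (auto simp: vertex_cycle_def successively_append_iff successively_Cons)
  moreover have "successively E (a # (c # rev B) @ [b])"
    using cyc chords sym
    by (cases "B = []") (auto simp: vertex_cycle_def successively_append_iff successively_Cons
        rev hd_append hd_rev last_rev intro: symE simp del: successively_rev)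
  moreover have "successively E (a # (rev D @ [d]) @ [b])"
    using cyc chords sym
    by (cases "D = []") (auto simp: vertex_cycle_def successively_append_iff successively_Cons
        rev hd_append hd_rev last_rev intro: symE simp del: successively_rev)
  moreover have "distinct (a # b # A @ (c # rev B) @ (rev D @ [d]))"
    using cyc by (auto simp: vertex_cycle_def)
  ultimately show False
    using theta A unfolding theta_free_def by blast
qed

text \<open>By rotating the cycle, each of the four gaps in turn takes the place of
  \<open>A\<close>. The remaining case is the complete graph on four vertices, which is too small to
  contain a theta.\<close>

lemma crossing_chords_theta:
  assumes sym: "symp E" and theta: "theta_free E"
    and cyc: "vertex_cycle E (a # A @ b # B @ c # C @ d # D)" and chords: "E a c" "E b d"
  shows "length (a # A @ b # B @ c # C @ d # D) = 4"
proof -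
  have symE: "E u w \<Longrightarrow> E w u" for u w
    using sym by (auto simp: symp_def)
  have "vertex_cycle E (b # B @ c # C @ d # D @ a # A)"
    using vertex_cycle_rotate[of E "a # A" "b # B @ c # C @ d # D"] cyc by simp
  moreover have "vertex_cycle E (c # C @ d # D @ a # A @ b # B)"
    using vertex_cycle_rotate[of E "a # A @ b # B" "c # C @ d # D"] cyc by simp
  moreover have "vertex_cycle E (d # D @ a # A @ b # B @ c # C)"
    using vertex_cycle_rotate[of E "a # A @ b # B @ c # C" "d # D"] cyc by simp
  ultimately have "A = []" "B = []" "C = []" "D = []"
    using crossing_chords_theta_aux[OF sym theta] cyc chords symE by blast+
  then show ?thesis
    by simp
qed

lemma noncrossing_cycle:
  assumes sym: "symp E" and theta: "theta_free E" and cyc: "vertex_cycle E xs" and len: "5 \<le> length xs"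
    and ijkm: "i < j" "j < k" "k < m" "m < length xs"
    and chords: "E (xs ! i) (xs ! k)"
  shows "\<not> E (xs ! j) (xs ! m)"
proof
  assume E: "E (xs ! j) (xs ! m)"
  \<comment> \<open>Splits the cycle at given positions, to bring it into the shape with four marked
    vertices.\<close>
  have cut: "drop s xs = xs ! s # take (t - Suc s) (drop (Suc s) xs) @ drop t xs"
    if "s < t" "t < length xs" for s t
  proof -
    have "drop s xs = xs ! s # drop (Suc s) xs"
      using that by (simp add: Cons_nth_drop_Suc)
    also have "drop (Suc s) xs = take (t - Suc s) (drop (Suc s) xs) @ drop (t - Suc s) (drop (Suc s) xs)"
      by (simp only: append_take_drop_id)
    also have "drop (t - Suc s) (drop (Suc s) xs) = drop t xs"
      using that by simp
    finally show ?thesis .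
  qed
  have "drop m xs = xs ! m # drop (Suc m) xs"
    using ijkm by (simp add: Cons_nth_drop_Suc)
  with cut[of i j] cut[of j k] cut[of k m] ijkm
  obtain S1 S2 S3 S4 where "drop i xs = xs ! i # S1 @ xs ! j # S2 @ xs ! k # S3 @ xs ! m # S4"
    by auto
  then have xs: "xs = take i xs @ xs ! i # S1 @ xs ! j # S2 @ xs ! k # S3 @ xs ! m # S4"
    by (metis append_take_drop_id)
  then have "vertex_cycle E (take i xs @ xs ! i # S1 @ xs ! j # S2 @ xs ! k # S3 @ xs ! m # S4)"
    using cyc by metis
  from vertex_cycle_rotate[OF this]
  have "vertex_cycle E (xs ! i # S1 @ xs ! j # S2 @ xs ! k # S3 @ xs ! m # (S4 @ take i xs))"
    by simp
  from crossing_chords_theta[OF sym theta this chords E]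
  have "length (S1 @ S2 @ S3 @ S4 @ take i xs) = 0"
    by simp
  moreover have "length xs = length (S1 @ S2 @ S3 @ S4 @ take i xs) + 4"
    using arg_cong[OF xs, of length] by simp
  ultimately show False
    using len by linarith
qed

subsection \<open>Outerplanar drawings\<close>

abbreviation adj :: "'a pair_pre_digraph \<Rightarrow> 'a \<Rightarrow> 'a \<Rightarrow> bool" where
  "adj G u v \<equiv> (u, v) \<in> parcs G"

section \<open>Vertex paths drawn as arcs\<close>

fun path_edges :: "'a list \<Rightarrow> 'a set set" where
  "path_edges (x # y # zs) = insert {x, y} (path_edges (y # zs))"
| "path_edges _ = {}"

lemma path_edges_subset: "e \<in> path_edges xs \<Longrightarrow> e \<subseteq> set xs"
  by (induction xs rule: path_edges.induct) auto

lemma path_edges_edges: "successively (adj G) xs \<Longrightarrow> e \<in> path_edges xs \<Longrightarrow> e \<in> edges G"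
  by (induction xs rule: path_edges.induct) (auto simp: edges_def)

lemma in_path_edges: "v \<in> set xs \<Longrightarrow> 2 \<le> length xs \<Longrightarrow> \<exists>e \<in> path_edges xs. v \<in> e"
proof (induction xs rule: path_edges.induct)
  case (1 x y zs)
  then show ?case
    by (cases zs) auto
qed auto

lemma path_edges_meet_snoc: "P \<noteq> [] \<Longrightarrow> e \<in> path_edges (P @ [b]) \<Longrightarrow> e \<inter> set P \<noteq> {}"
proof (induction P)
  case (Cons y P)
  then show ?case
    by (cases P) auto
qed simp

lemma path_edges_meet_interior:
  "P \<noteq> [] \<Longrightarrow> e \<in> path_edges (a # P @ [b]) \<Longrightarrow> e \<inter> set P \<noteq> {}"
  using path_edges_meet_snoc[of P e b] by (cases P) auto

text \<open>The drawn edges are joined one after the other, each reversed first if it is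
  parametrised against the direction of the path.\<close>

lemma path_arc:
  assumes draw: "plane_drawing G p \<gamma>"
  shows "2 \<le> length xs \<Longrightarrow> distinct xs \<Longrightarrow> successively (adj G) xs \<Longrightarrow>
    \<exists>g. arc g \<and> pathstart g = p (hd xs) \<and> pathfinish g = p (last xs) \<and>
      path_image g = (\<Union>e\<in>path_edges xs. path_image (\<gamma> e))"
proof (induction xs rule: path_edges.induct)
  case (1 x y zs)
  have e: "{x, y} \<in> edges G"
    using 1 by (auto simp: edges_def)
  then have \<gamma>: "arc (\<gamma> {x, y})" "{pathstart (\<gamma> {x, y}), pathfinish (\<gamma> {x, y})} = {p x, p y}"
    using draw by (auto simp: plane_drawing_def)
  obtain h where h: "arc h" "pathstart h = p x" "pathfinish h = p y" "path_image h = path_image (\<gamma> {x, y})"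
  proof (cases "pathstart (\<gamma> {x, y}) = p x")
    case True
    then have "pathfinish (\<gamma> {x, y}) = p y"
      using \<gamma> arc_distinct_ends[OF \<gamma>(1)] by (auto simp: doubleton_eq_iff)
    with True \<gamma> that show thesis
      by blast
  next
    case False
    then have "pathstart (\<gamma> {x, y}) = p y" "pathfinish (\<gamma> {x, y}) = p x"
      using \<gamma>(2) by (auto simp: doubleton_eq_iff)
    then show thesis
      using that[of "reversepath (\<gamma> {x, y})"] \<gamma>(1) by (simp add: arc_reversepath)
  qed
  show ?case
  proof (cases zs)
    case Nil
    with h show ?thesis
      by (intro exI[of _ h]) simp
  next
    case (Cons z zs')
    have "\<exists>g. arc g \<and> pathstart g = p (hd (y # zs)) \<and> pathfinish g = p (last (y # zs)) \<and>
      path_image g = (\<Union>e\<in>path_edges (y # zs). path_image (\<gamma> e))"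
      using 1 Cons by auto
    then obtain g where g: "arc g" "pathstart g = p y" "pathfinish g = p (last (y # zs))"
      "path_image g = (\<Union>e\<in>path_edges (y # zs). path_image (\<gamma> e))"
      by auto
    \<comment> \<open>As the vertices are distinct, no later edge contains \<open>x\<close>, so the
      first edge can meet the later ones only in \<open>y\<close>.\<close>
    have "path_image h \<inter> path_image g \<subseteq> {p y}"
    proof
      fix t assume t: "t \<in> path_image h \<inter> path_image g"
      then obtain f where f: "f \<in> path_edges (y # zs)" "t \<in> path_image (\<gamma> f)"
        using g(4) by auto
      have fsub: "f \<subseteq> set (y # zs)" and "f \<in> edges G"
        using path_edges_subset[OF f(1)] path_edges_edges[OF _ f(1)] 1 by auto
      moreover have "x \<notin> f"
        using fsub 1 by auto
      then have "f \<noteq> {x, y}"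
        by auto
      ultimately have "path_image (\<gamma> {x, y}) \<inter> path_image (\<gamma> f) \<subseteq> p ` ({x, y} \<inter> f)"
        using draw e unfolding plane_drawing_def by metis
      then show "t \<in> {p y}"
        using t f h(4) \<open>x \<notin> f\<close> by auto
    qed
    then have "arc (h +++ g)"
      using h g by (intro arc_join) auto
    then show ?thesis
      using h g by (intro exI[of _ "h +++ g"]) (simp add: path_image_join)
  qed
qed auto

text \<open>By \<open>theta_inside\<close> one path of a theta would run inside the closed curve of
  the other two. An interior vertex of it would then have a neighbourhood disjoint from the
  unbounded face, contrary to lying on the frontier of that face.\<close>

lemma outerplanar_theta_free:
  fixes G :: "'a pair_pre_digraph"
  assumes wf: "pair_wf_digraph G" and "outerplanar G"
  shows "theta_free (adj G)"
  unfolding theta_free_def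
proof (intro allI impI notI)
  fix a b :: 'a and P Q R
  assume ne: "P \<noteq> [] \<and> Q \<noteq> [] \<and> R \<noteq> [] \<and> distinct (a # b # P @ Q @ R)"
  assume paths: "successively (adj G) (a # P @ [b]) \<and> successively (adj G) (a # Q @ [b]) \<and>
    successively (adj G) (a # R @ [b])"
  obtain p \<gamma> where draw: "plane_drawing G p \<gamma>"
    and outer: "\<And>v. v \<in> pverts G \<Longrightarrow> p v \<in> frontier (outside (drawing_image G p \<gamma>))"
    using assms(2) by (auto simp: outerplanar_def)
  have edge_verts: "e \<subseteq> pverts G" if "e \<in> edges G" for e
    using that pair_wf_digraph.in_arcsD1[OF wf] pair_wf_digraph.in_arcsD2[OF wf]
    by (auto simp: edges_def)
  have inj: "inj_on p (pverts G)"
    using draw by (simp add: plane_drawing_def)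
  define \<Theta> where "\<Theta> S g \<longleftrightarrow> arc g \<and> pathstart g = p a \<and> pathfinish g = p b \<and>
      path_image g = (\<Union>e\<in>path_edges (a # S @ [b]). path_image (\<gamma> e))" for S g
  have ex: "\<exists>g. \<Theta> S g" if "S \<noteq> []" "distinct (a # S @ [b])" "successively (adj G) (a # S @ [b])" for S
    using path_arc[OF draw, of "a # S @ [b]"] that by (simp add: \<Theta>_def)
  obtain g1 g2 g3 where g: "\<Theta> P g1" "\<Theta> Q g2" "\<Theta> R g3"
    using ex[of P] ex[of Q] ex[of R] ne paths by auto
  have meet: "path_image g \<inter> path_image h = {p a, p b}"
    if gh: "\<Theta> S g" "\<Theta> T h" and ST: "S \<noteq> []" "T \<noteq> []" "distinct (a # b # S @ T)"
      "successively (adj G) (a # S @ [b])" "successively (adj G) (a # T @ [b])" for S T g h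
  proof
    show "{p a, p b} \<subseteq> path_image g \<inter> path_image h"
      using gh unfolding \<Theta>_def by (metis Int_iff empty_subsetI insert_subset pathfinish_in_path_image pathstart_in_path_image)
    show "path_image g \<inter> path_image h \<subseteq> {p a, p b}"
    proof
      fix t assume "t \<in> path_image g \<inter> path_image h"
      then obtain e f where ef: "e \<in> path_edges (a # S @ [b])" "t \<in> path_image (\<gamma> e)"
        "f \<in> path_edges (a # T @ [b])" "t \<in> path_image (\<gamma> f)"
        using gh by (auto simp: \<Theta>_def)
      have sub: "e \<subseteq> insert a (insert b (set S))" "f \<subseteq> insert a (insert b (set T))"
        using path_edges_subset[OF ef(1)] path_edges_subset[OF ef(3)] by auto
      then have "e \<inter> f \<subseteq> {a, b}"
        using ST(3) by auto
      \<comment> \<open>An edge of the path through \<open>S\<close> contains a vertex of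
        \<open>S\<close>, which no edge of the path through \<open>T\<close> does.\<close>
      moreover have "e \<noteq> f"
        using path_edges_meet_interior[OF ST(1) ef(1)] sub(2) ST(3) by auto
      then have "path_image (\<gamma> e) \<inter> path_image (\<gamma> f) \<subseteq> p ` (e \<inter> f)"
        using draw path_edges_edges[OF ST(4) ef(1)] path_edges_edges[OF ST(5) ef(3)]
        unfolding plane_drawing_def by metis
      ultimately show "t \<in> {p a, p b}"
        using ef by blast
    qed
  qed
  have image_sub: "path_image g \<subseteq> drawing_image G p \<gamma>"
    if "\<Theta> S g" "successively (adj G) (a # S @ [b])" for S g
    using that path_edges_edges[OF that(2)] by (auto simp: \<Theta>_def drawing_image_def)
  have no_inside: False
    if gs: "\<Theta> S g" "S \<noteq> []" "successively (adj G) (a # S @ [b])" "distinct (a # S @ [b])"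
      and CD: "\<Theta> T h" "\<Theta> U k" "successively (adj G) (a # T @ [b])" "successively (adj G) (a # U @ [b])"
      and inside: "path_image g - {p a, p b} \<subseteq> inside (path_image h \<union> path_image k)" for S T U g h k
  proof -
    obtain v where v: "v \<in> set S"
      using gs(2) by (meson last_in_set)
    obtain e where e: "e \<in> path_edges (a # S @ [b])" "v \<in> e"
      using in_path_edges[of v "a # S @ [b]"] v by auto
    then have eG: "e \<in> edges G"
      using path_edges_edges[OF gs(3)] by blast
    obtain ea where "ea \<in> path_edges (a # S @ [b])" "a \<in> ea"
      using in_path_edges[of a "a # S @ [b]"] by auto
    moreover obtain eb where "eb \<in> path_edges (a # S @ [b])" "b \<in> eb"
      using in_path_edges[of b "a # S @ [b]"] by auto
    ultimately have V: "a \<in> pverts G" "b \<in> pverts G" "v \<in> pverts G"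
      using edge_verts path_edges_edges[OF gs(3)] e by blast+
    have "p v \<in> path_image (\<gamma> e)"
    proof -
      have "p v \<in> {pathstart (\<gamma> e), pathfinish (\<gamma> e)}"
        using draw eG e(2) unfolding plane_drawing_def by auto
      then show ?thesis
        by auto
    qed
    then have "p v \<in> path_image g"
      using gs(1) e by (auto simp: \<Theta>_def)
    moreover have "p v \<noteq> p a" "p v \<noteq> p b"
      using inj V v gs(4) by (auto simp: inj_on_eq_iff)
    ultimately have pv: "p v \<in> inside (path_image h \<union> path_image k)"
      using inside by blast
    have "closed (path_image h \<union> path_image k)"
    proof -
      have "arc h" "arc k"
        using CD by (simp_all add: \<Theta>_def)
      then show ?thesis
        by (intro closed_Un closed_arc_image)
    qed
    then have "open (inside (path_image h \<union> path_image k))"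
      by (rule open_inside)
    moreover have "p v \<in> closure (outside (drawing_image G p \<gamma>))"
      using outer[OF V(3)] by (simp add: frontier_def)
    ultimately have "inside (path_image h \<union> path_image k) \<inter> outside (drawing_image G p \<gamma>) \<noteq> {}"
      using pv by (meson disjoint_iff open_Int_closure_eq_empty)
    \<comment> \<open>The outside shrinks as the set grows, so the unbounded face of the drawing
      avoids the inside of the closed curve.\<close>
    moreover have "outside (drawing_image G p \<gamma>) \<subseteq> outside (path_image h \<union> path_image k)"
      using image_sub[OF CD(1,3)] image_sub[OF CD(2,4)] by (intro outside_mono) auto
    ultimately show False
      using inside_Int_outside[of "path_image h \<union> path_image k"] by blast
  qed
  have "path_image g1 - {p a, p b} \<subseteq> inside (path_image g2 \<union> path_image g3) \<or>
         path_image g2 - {p a, p b} \<subseteq> inside (path_image g1 \<union> path_image g3) \<or>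
         path_image g3 - {p a, p b} \<subseteq> inside (path_image g1 \<union> path_image g2)"
  proof (rule theta_inside)
    show "path_image g1 \<inter> path_image g2 = {p a, p b}"
      by (rule meet[OF g(1,2)]) (use ne paths in auto)
    show "path_image g1 \<inter> path_image g3 = {p a, p b}"
      by (rule meet[OF g(1,3)]) (use ne paths in auto)
    show "path_image g2 \<inter> path_image g3 = {p a, p b}"
      by (rule meet[OF g(2,3)]) (use ne paths in auto)
  qed (use g in \<open>auto simp: \<Theta>_def\<close>)
  then show False
    using no_inside[OF g(1) _ _ _ g(2,3)] no_inside[OF g(2) _ _ _ g(1,3)] no_inside[OF g(3) _ _ _ g(1,2)]
      ne paths by auto
qed

subsection \<open>Distributing colours at a cut vertex\<close>

text \<open>Bounded quantifiers as recursions that stop once the answer is known, so that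
  \<open>code_simp\<close> can run the finite check.\<close>

fun some_below :: "nat \<Rightarrow> (nat \<Rightarrow> bool) \<Rightarrow> bool" where
  "some_below 0 P = False"
| "some_below (Suc n) P = (if P n then True else some_below n P)"

fun all_below :: "nat \<Rightarrow> (nat \<Rightarrow> bool) \<Rightarrow> bool" where
  "all_below 0 P = True"
| "all_below (Suc n) P = (if P n then all_below n P else False)"

lemma some_below_iff: "some_below n P \<longleftrightarrow> (\<exists>i<n. P i)"
  by (induction n) (auto simp: less_Suc_eq)

lemma all_below_iff: "all_below n P \<longleftrightarrow> (\<forall>i<n. P i)"
  by (induction n) (auto simp: less_Suc_eq)

text \<open>The case distinctions below are written with conditionals rather than connectives because only
  conditionals are evaluated lazily by rewriting.

  Counts describe a state \<open>p, A, q, B\<close>: \<open>a\<close>, \<open>b\<close> and \<open>i\<close> are the sizes of \<open>A\<close>, \<open>B\<close> and \<open>A \<inter> B\<close>,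
  while \<open>\<alpha>\<close> and \<open>\<beta>\<close> are 1 or 0 according to whether \<open>q \<in> A\<close> and \<open>p \<in> B\<close>. The flag \<open>m\<close> is set for
  those intervals whose colourings are only known to make \<open>A\<close> and \<open>B\<close> disjoint; this happens, for
  instance, when the interval is a path with three edges.\<close>

definition compatible_counts :: "bool \<Rightarrow> nat \<Rightarrow> nat \<Rightarrow> nat \<Rightarrow> nat \<Rightarrow> nat \<Rightarrow> bool" where
  "compatible_counts m a b \<alpha> \<beta> i \<longleftrightarrow>
     (\<alpha> = 0 \<or> 3 \<le> a) \<and> (\<beta> = 0 \<or> 3 \<le> b) \<and>
     (a = 0 \<and> b = 0 \<or> (if m then i = 0 else 0 < i \<and> (a = \<alpha> + 2 \<and> b = \<beta> + 2 \<longrightarrow> i = 1)))"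

text \<open>Both counts vanish only for an interval of two vertices: a longer one contains the
  successor of \<open>l\<close> and the predecessor of \<open>r\<close>. Besides the two counts, the
  flag is all that is remembered about a part of the interval.\<close>

definition admissible :: "bool \<Rightarrow> nat \<Rightarrow> nat \<Rightarrow> bool" where
  "admissible m a b \<longleftrightarrow> (a = 0 \<longleftrightarrow> b = 0) \<and> (m \<longrightarrow> 0 < a \<and> a + b \<le> 3)"

text \<open>Let \<open>nst\<close> be the number of colours besides \<open>p\<close> and \<open>q\<close> whose membership in \<open>A\<close> and \<open>B\<close> is \<open>s\<close> and
  \<open>t\<close>, and \<open>kst\<close> the number that remains when the colour of the cut vertex \<open>w\<close> is removed; \<open>v\<close> tells
  whether that colour lies in \<open>A\<close> and \<open>e\<close> whether \<open>w\<close> is adjacent to \<open>l\<close>. The search is for the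
  numbers of colours that the \<open>x\<close> left and \<open>y\<close> right neighbours of \<open>w\<close> take from each region, where
  \<open>\<xi>\<close> and \<open>\<upsilon>\<close> count the uses of \<open>p\<close>.\<close>

definition splittable_at ::
    "bool \<Rightarrow> bool \<Rightarrow> nat \<Rightarrow> nat \<Rightarrow> nat \<Rightarrow> nat \<Rightarrow> nat \<Rightarrow> nat \<Rightarrow> nat \<Rightarrow> nat \<Rightarrow> nat \<Rightarrow> bool \<Rightarrow> bool \<Rightarrow> bool" where
  "splittable_at e v k11 n10 k01 n00 \<beta> a1 x y b2 m1 m2 \<longleftrightarrow>
     some_below (if e then 1 else 2) (\<lambda>\<xi>. some_below (Suc k11) (\<lambda>x11. some_below (Suc n10) (\<lambda>x10.
       if x11 + x10 + \<xi> \<le> x then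
       if compatible_counts m1 a1 x (if v then if e then 0 else 1 else 0) \<xi> (x11 + x10) then
       some_below (Suc k01) (\<lambda>x01.
         if x11 + x10 + \<xi> + x01 \<le> x then
         if x \<le> x11 + x10 + \<xi> + x01 + n00 then
         some_below (if e then 1 else 2 - \<xi>) (\<lambda>\<upsilon>.
         some_below (Suc k11 - x11) (\<lambda>y11. some_below (Suc k01 - x01) (\<lambda>y01.
           if compatible_counts m2 y b2 0 0 (y11 + y01 + \<upsilon> * \<beta>) then
           if \<upsilon> + y11 + y01 \<le> y then
           y + x10 + (x - (x11 + x10 + \<xi> + x01)) \<le> \<upsilon> + y11 + y01 + n10 + n00
           else False else False)))
         else False else False)
       else False else False)))"

text \<open>Since \<open>w\<close> is adjacent to \<open>r\<close>, its colour comes from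
  \<open>B\<close>: either from the common part with \<open>A\<close> or, if \<open>w\<close> is not
  adjacent to \<open>l\<close>, from the rest of \<open>B\<close>.\<close>

definition splittable ::
    "bool \<Rightarrow> nat \<Rightarrow> nat \<Rightarrow> nat \<Rightarrow> nat \<Rightarrow> nat \<Rightarrow> nat \<Rightarrow> nat \<Rightarrow> nat \<Rightarrow> nat \<Rightarrow> bool \<Rightarrow> bool \<Rightarrow> bool" where
  "splittable e n11 n10 n01 n00 \<beta> a1 x y b2 m1 m2 \<longleftrightarrow>
     (if if n11 = 0 then False
         else splittable_at e True (n11 - 1) n10 n01 n00 \<beta> a1 x y b2 m1 m2 then True
      else if e then False else if n01 = 0 then False
      else splittable_at e False n11 n10 (n01 - 1) n00 \<beta> a1 x y b2 m1 m2)"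

text \<open>The bounds say that \<open>x + y\<close>, plus 1 if \<open>e\<close> holds, is at most
  5: \<open>w\<close> has degree at most 6, and \<open>r\<close> is one of its neighbours. The flags
  are encoded as 0 and 1. Five colours differ from \<open>p\<close> and \<open>q\<close>, which
  determines the last region.\<close>

definition all_splittable :: "bool \<Rightarrow> nat \<Rightarrow> nat \<Rightarrow> nat \<Rightarrow> nat \<Rightarrow> nat \<Rightarrow> nat \<Rightarrow> bool" where
  "all_splittable e n11 n10 n01 \<beta> a1 b2 \<longleftrightarrow>
     all_below (if e then 5 else 6) (\<lambda>x. all_below ((if e then 5 else 6) - x) (\<lambda>y.
     all_below 2 (\<lambda>m1. all_below 2 (\<lambda>m2.
       if admissible (m1 = 1) a1 x then if admissible (m2 = 1) y b2 then
       splittable e n11 n10 n01 (5 - (n11 + n10 + n01)) \<beta> a1 x y b2 (m1 = 1) (m2 = 1)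
       else True else True))))"

text \<open>The count at \<open>r\<close> always drops by one when \<open>w\<close> is split off,
  the count at \<open>l\<close> only if \<open>e\<close> holds. The flag of the whole interval is
  set if \<open>e\<close> fails and the two counts add up to at most 3.\<close>

definition all_states :: "bool \<Rightarrow> nat \<Rightarrow> bool" where
  "all_states e n11 = all_below (6 - n11) (\<lambda>n10. all_below (6 - (n11 + n10)) (\<lambda>n01.
     all_below 2 (\<lambda>\<alpha>. all_below 2 (\<lambda>\<beta>.
      if n11 + n10 + \<alpha> = 0 then True else if n11 + n01 + \<beta> = 0 then True else
      if n11 + n10 + \<alpha> \<le> 5 then if n11 + n01 + \<beta> \<le> 5 then
      if compatible_counts (if e then False else n11 + n10 + \<alpha> + (n11 + n01 + \<beta>) \<le> 3)
           (n11 + n10 + \<alpha>) (n11 + n01 + \<beta>) \<alpha> \<beta> n11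
      then all_splittable e n11 n10 n01 \<beta> (n11 + n10 + \<alpha> - (if e then 1 else 0)) (n11 + n01 + \<beta> - 1)
      else True else True else True))))"

text \<open>The finite check itself, by evaluation, here and in the next lemma for the other value
  of \<open>e\<close>.\<close>

lemma all_states_True: "all_below 6 (all_states True)" by code_simp
lemma all_states_False: "all_below 6 (all_states False)" by code_simp

section \<open>From region sizes to sets of colours\<close>

definition compatible_state :: "bool \<Rightarrow> nat \<Rightarrow> nat set \<Rightarrow> nat \<Rightarrow> nat set \<Rightarrow> bool" where
  "compatible_state m p A q B \<longleftrightarrow> p \<noteq> q \<and> p \<notin> A \<and> q \<notin> B \<and>
     compatible_counts m (card A) (card B) (card (A \<inter> {q})) (card (B \<inter> {p})) (card (A \<inter> B))"

lemma all_statesD: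
  assumes "all_states e n11" "n11 + n10 + n01 \<le> 5" "\<alpha> < 2" "\<beta> < 2"
    "0 < n11 + n10 + \<alpha>" "n11 + n10 + \<alpha> \<le> 5" "0 < n11 + n01 + \<beta>" "n11 + n01 + \<beta> \<le> 5"
    "compatible_counts (\<not> e \<and> n11 + n10 + \<alpha> + (n11 + n01 + \<beta>) \<le> 3)
       (n11 + n10 + \<alpha>) (n11 + n01 + \<beta>) \<alpha> \<beta> n11"
  shows "all_splittable e n11 n10 n01 \<beta> (n11 + n10 + \<alpha> - (if e then 1 else 0)) (n11 + n01 + \<beta> - 1)"
proof -
  have "n10 < 6 - n11" "n01 < 6 - (n11 + n10)"
    using assms(2) by auto
  note * = assms(1)[unfolded all_states_def all_below_iff, rule_format, OF this assms(3,4)]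
  have eq: "(if e then False else n11 + n10 + \<alpha> + (n11 + n01 + \<beta>) \<le> 3) \<longleftrightarrow>
      \<not> e \<and> n11 + n10 + \<alpha> + (n11 + n01 + \<beta>) \<le> 3"
    by simp
  have "n11 + n10 + \<alpha> \<noteq> 0" "n11 + n01 + \<beta> \<noteq> 0"
    using assms(5,7) by simp_all
  then show ?thesis
    using *[unfolded eq] assms(6,8,9) by (simp only: if_True if_False)
qed

lemma all_splittableD:
  assumes "all_splittable e n11 n10 n01 \<beta> a1 b2" "x + y + (if e then 1 else 0) \<le> 5"
    "admissible m1 a1 x" "admissible m2 y b2"
  shows "splittable e n11 n10 n01 (5 - (n11 + n10 + n01)) \<beta> a1 x y b2 m1 m2"
proof -
  have lt: "x < (if e then 5 else 6)" "y < (if e then 5 else 6) - x"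
    "of_bool m1 < (2::nat)" "of_bool m2 < (2::nat)"
    using assms(2) by (auto split: if_splits)
  have eq: "of_bool m1 = (1::nat) \<longleftrightarrow> m1" "of_bool m2 = (1::nat) \<longleftrightarrow> m2"
    by auto
  show ?thesis
    using assms(1)[unfolded all_splittable_def all_below_iff, rule_format, OF lt]
    unfolding eq if_P[OF assms(3)] if_P[OF assms(4)] .
qed

text \<open>Subsets of the prescribed sizes are picked in each region, those for \<open>Y\<close>
  from what \<open>X\<close> leaves over. \<open>M11\<close> and \<open>M01\<close> are the regions
  of \<open>B\<close> after removal of the colour of the cut vertex.\<close>

lemma splittable_at_imp_sets:
  fixes M11 N10 M01 N00 :: "nat set"
  assumes split: "splittable_at e v (card M11) (card N10) (card M01) (card N00) \<beta> a1 x y b2 m1 m2"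
    and fin: "finite M11" "finite N10" "finite M01" "finite N00"
    and disj: "M11 \<inter> N10 = {}" "M11 \<inter> M01 = {}" "M11 \<inter> N00 = {}" "N10 \<inter> M01 = {}"
      "N10 \<inter> N00 = {}" "M01 \<inter> N00 = {}"
    and p: "p \<notin> M11 \<union> N10 \<union> M01 \<union> N00"
  shows "\<exists>X Y. X \<subseteq> insert p (M11 \<union> N10 \<union> M01 \<union> N00) \<and> Y \<subseteq> insert p (M11 \<union> N10 \<union> M01 \<union> N00) \<and>
     X \<inter> Y = {} \<and> card X = x \<and> card Y = y \<and> (e \<longrightarrow> p \<notin> X \<and> p \<notin> Y) \<and>
     compatible_counts m1 a1 x (if v \<and> \<not> e then 1 else 0) (card (X \<inter> {p})) (card (X \<inter> (M11 \<union> N10))) \<and>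
     compatible_counts m2 y b2 0 0 (card (Y \<inter> (M11 \<union> M01)) + card (Y \<inter> {p}) * \<beta>)"
proof -
  obtain \<xi> x11 x10 x01 \<upsilon> y11 y01 where
    w: "\<xi> < (if e then 1 else 2)" "x11 \<le> card M11" "x10 \<le> card N10" "x01 \<le> card M01"
      "x11 + x10 + \<xi> + x01 \<le> x" "x \<le> x11 + x10 + \<xi> + x01 + card N00"
      "compatible_counts m1 a1 x (if v \<and> \<not> e then 1 else 0) \<xi> (x11 + x10)"
      "\<upsilon> < (if e then 1 else 2 - \<xi>)" "y11 + x11 \<le> card M11" "y01 + x01 \<le> card M01"
      "compatible_counts m2 y b2 0 0 (y11 + y01 + \<upsilon> * \<beta>)" "\<upsilon> + y11 + y01 \<le> y"
      "y + x10 + (x - (x11 + x10 + \<xi> + x01)) \<le> \<upsilon> + y11 + y01 + card N10 + card N00"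
  proof -
    have v: "(if v then if e then 0 else 1 else 0) = (if v \<and> \<not> e then 1 else (0::nat))"
      by simp
    have conj: "(if b then c else False) \<longleftrightarrow> b \<and> c" for b c
      by simp
    from split obtain \<xi> x11 x10 x01 \<upsilon> y11 y01 where
      *: "\<xi> < (if e then 1 else 2)" "x11 < Suc (card M11)" "x10 < Suc (card N10)" "x01 < Suc (card M01)"
      "x11 + x10 + \<xi> + x01 \<le> x" "x \<le> x11 + x10 + \<xi> + x01 + card N00"
      "compatible_counts m1 a1 x (if v \<and> \<not> e then 1 else 0) \<xi> (x11 + x10)"
      "\<upsilon> < (if e then 1 else 2 - \<xi>)" "y11 < Suc (card M11) - x11" "y01 < Suc (card M01) - x01"
      "compatible_counts m2 y b2 0 0 (y11 + y01 + \<upsilon> * \<beta>)" "\<upsilon> + y11 + y01 \<le> y"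
      "y + x10 + (x - (x11 + x10 + \<xi> + x01)) \<le> \<upsilon> + y11 + y01 + card N10 + card N00"
      unfolding splittable_at_def some_below_iff conj v by (elim exE conjE) (rule that)
    have "x11 \<le> card M11" "x10 \<le> card N10" "x01 \<le> card M01" "y11 + x11 \<le> card M11" "y01 + x01 \<le> card M01"
      using *(2-4,9,10) by linarith+
    then show thesis
      using that *(1,5-8,11-13) by blast
  qed
  define x00 where "x00 = x - (x11 + x10 + \<xi> + x01)"
  \<comment> \<open>The rest of \<open>Y\<close> is taken from \<open>N10\<close> and
    \<open>N00\<close> together: the condition on \<open>Y\<close> concerns only its intersection
    with \<open>B\<close>.\<close>
  define yr where "yr = y - (\<upsilon> + y11 + y01)"
  obtain X11 where X11: "X11 \<subseteq> M11" "card X11 = x11"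
    using w(2) by (meson obtain_subset_with_card_n)
  obtain X10 where X10: "X10 \<subseteq> N10" "card X10 = x10"
    using w(3) by (meson obtain_subset_with_card_n)
  obtain X01 where X01: "X01 \<subseteq> M01" "card X01 = x01"
    using w(4) by (meson obtain_subset_with_card_n)
  have "x00 \<le> card N00"
    using w(6) by (simp add: x00_def)
  then obtain X00 where X00: "X00 \<subseteq> N00" "card X00 = x00"
    by (meson obtain_subset_with_card_n)
  have finX: "finite X11" "finite X10" "finite X01" "finite X00"
    using X11 X10 X01 X00 fin finite_subset by auto
  have "y11 \<le> card (M11 - X11)"
    using w(9) X11 finX by (simp add: card_Diff_subset)
  then obtain Y11 where Y11: "Y11 \<subseteq> M11 - X11" "card Y11 = y11"
    by (meson obtain_subset_with_card_n)
  have "y01 \<le> card (M01 - X01)"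
    using w(10) X01 finX by (simp add: card_Diff_subset)
  then obtain Y01 where Y01: "Y01 \<subseteq> M01 - X01" "card Y01 = y01"
    by (meson obtain_subset_with_card_n)
  have "card ((N10 - X10) \<union> (N00 - X00)) = (card N10 - x10) + (card N00 - x00)"
    using X10 X00 finX fin disj by (subst card_Un_disjoint) (auto simp: card_Diff_subset)
  then have "yr \<le> card ((N10 - X10) \<union> (N00 - X00))"
    using w(3,6,13) \<open>x00 \<le> card N00\<close> by (simp add: yr_def x00_def)
  then obtain Yr where Yr: "Yr \<subseteq> (N10 - X10) \<union> (N00 - X00)" "card Yr = yr"
    by (meson obtain_subset_with_card_n)
  have finY: "finite Y11" "finite Y01" "finite Yr"
    using Y11 Y01 Yr fin by (meson finite_Diff finite_UnI finite_subset)+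
  \<comment> \<open>The use of the colour \<open>p\<close>: by at most one of \<open>X\<close> and
    \<open>Y\<close>, and by neither if \<open>e\<close> holds, because then the neighbour
    \<open>l\<close> of the cut vertex has it.\<close>
  define P where "P = (if \<xi> = 0 then {} else {p})"
  define Q where "Q = (if \<upsilon> = 0 then {} else {p})"
  have cP: "card P = \<xi>" and cQ: "card Q = \<upsilon>"
    using w(1,8) by (auto simp: P_def Q_def split: if_splits)
  have PQ: "P \<inter> Q = {}"
    using w(1,8) by (auto simp: P_def Q_def split: if_splits)
  have e: "e \<Longrightarrow> P = {} \<and> Q = {}"
    using w(1,8) by (auto simp: P_def Q_def)
  have PQp: "P \<subseteq> {p}" "Q \<subseteq> {p}" "finite P" "finite Q"
    by (auto simp: P_def Q_def)
  define X where "X = X11 \<union> X10 \<union> X01 \<union> X00 \<union> P"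
  define Y where "Y = Y11 \<union> Y01 \<union> Yr \<union> Q"
  have dX: "X11 \<inter> X10 = {}" "(X11 \<union> X10) \<inter> X01 = {}" "(X11 \<union> X10 \<union> X01) \<inter> X00 = {}"
    "(X11 \<union> X10 \<union> X01 \<union> X00) \<inter> P = {}"
    using X11 X10 X01 X00 disj p PQp by blast+
  have dY: "Y11 \<inter> Y01 = {}" "(Y11 \<union> Y01) \<inter> Yr = {}" "(Y11 \<union> Y01 \<union> Yr) \<inter> Q = {}"
    using Y11 Y01 Yr disj p PQp by blast+
  have cX: "card X = x"
    using dX finX PQp X11 X10 X01 X00 cP w(5) by (simp add: X_def card_Un_disjoint x00_def)
  have cY: "card Y = y"
    using dY finY PQp Y11 Y01 Yr cQ w(12) by (simp add: Y_def card_Un_disjoint yr_def)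
  have "X \<inter> {p} = P" "Y \<inter> {p} = Q"
    using X11 X10 X01 X00 Y11 Y01 Yr p PQp unfolding X_def Y_def by blast+
  moreover have "X \<inter> (M11 \<union> N10) = X11 \<union> X10"
    using X11 X10 X01 X00 p PQp disj unfolding X_def by blast
  moreover have "Y \<inter> (M11 \<union> M01) = Y11 \<union> Y01"
    using Y11 Y01 Yr p PQp disj unfolding Y_def by blast
  moreover have "card (X11 \<union> X10) = x11 + x10" "card (Y11 \<union> Y01) = y11 + y01"
    using dX dY finX finY X11 X10 Y11 Y01 by (simp_all add: card_Un_disjoint)
  moreover have "X \<inter> Y = {}"
  proof -
    have "X \<inter> Y11 = {}"
      using X11 X10 X01 X00 PQp Y11 disj(1-3) p unfolding X_def by blast
    moreover have "X \<inter> Y01 = {}"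
      using X11 X10 X01 X00 PQp Y01 disj(2,4,6) p unfolding X_def by blast
    moreover have "X \<inter> Yr = {}"
    proof -
      have "X \<inter> (N10 - X10) = {}"
        using X11 X10 X01 X00 PQp disj(1,4,5) p unfolding X_def by blast
      moreover have "X \<inter> (N00 - X00) = {}"
        using X11 X10 X01 X00 PQp disj(3,5,6) p unfolding X_def by blast
      ultimately show ?thesis
        using Yr by blast
    qed
    moreover have "X \<inter> Q = {}"
      using X11 X10 X01 X00 PQp PQ p unfolding X_def by blast
    ultimately show ?thesis
      unfolding Y_def by blast
  qed
  moreover have "X \<subseteq> insert p (M11 \<union> N10 \<union> M01 \<union> N00)"
    using X11 X10 X01 X00 PQp unfolding X_def by blast
  moreover have "Y \<subseteq> insert p (M11 \<union> N10 \<union> M01 \<union> N00)"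
    using Y11 Y01 Yr PQp unfolding Y_def by blast
  moreover have "e \<longrightarrow> p \<notin> X \<and> p \<notin> Y"
    using e calculation(1,2) by blast
  ultimately show ?thesis
    using w cX cY cP cQ by (intro exI[of _ X] exI[of _ Y]) simp
qed

text \<open>Here \<open>w\<close> is the colour of the cut vertex, and \<open>X\<close> and
  \<open>Y\<close> are the colours of its neighbours on the left and on the right, apart from
  \<open>l\<close> and \<open>r\<close>. The Venn regions of \<open>A\<close> and \<open>B\<close>
  are measured and the finite check is looked up.\<close>

lemma compatible_state_split:
  assumes A: "A \<subseteq> {..<7}" "0 < card A" "card A \<le> 5" and B: "B \<subseteq> {..<7}" "0 < card B" "card B \<le> 5"
    and pq: "p < 7" "q < 7" and comp: "compatible_state (\<not> e \<and> card A + card B \<le> 3) p A q B"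
    and a1: "a1 = card A - (if e then 1 else 0)" and b2: "b2 = card B - 1"
    and xy: "x + y + (if e then 1 else 0) \<le> 5"
    and adm: "admissible m1 a1 x" "admissible m2 y b2"
  shows "\<exists>w X Y. X \<subseteq> {..<7} \<and> Y \<subseteq> {..<7} \<and> card X = x \<and> card Y = y \<and>
     w \<in> B \<and> (e \<longrightarrow> w \<in> A \<and> p \<notin> X \<and> p \<notin> Y) \<and> q \<notin> X \<and> q \<notin> Y \<and> X \<inter> Y = {} \<and>
     compatible_state m1 p (if e then A - {w} else A) w X \<and> compatible_state m2 w Y q (B - {w})"
proof -
  have pqAB: "p \<noteq> q" "p \<notin> A" "q \<notin> B"
    and cc: "compatible_counts (\<not> e \<and> card A + card B \<le> 3) (card A) (card B)
      (card (A \<inter> {q})) (card (B \<inter> {p})) (card (A \<inter> B))"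
    using comp by (auto simp: compatible_state_def)
  \<comment> \<open>The five colours other than \<open>p\<close> and \<open>q\<close>. The common
    part of \<open>A\<close> and \<open>B\<close> lies in \<open>D\<close> by itself, since
    \<open>p\<close> is not in \<open>A\<close> and \<open>q\<close> not in
    \<open>B\<close>.\<close>
  define D where "D = {..<7::nat} - {p, q}"
  define N11 N10 N01 N00 where "N11 = A \<inter> B" and "N10 = (D \<inter> A) - B" and "N01 = (D \<inter> B) - A"
    and "N00 = D - A - B"
  note N = N11_def N10_def N01_def N00_def
  have finAB: "finite A" "finite B"
    using A B finite_subset by blast+
  have fin: "finite N11" "finite N10" "finite N01" "finite N00"
    using finAB by (auto simp: N D_def)
  have disj: "N11 \<inter> N10 = {}" "N11 \<inter> N01 = {}" "N11 \<inter> N00 = {}" "N10 \<inter> N01 = {}"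
    "N10 \<inter> N00 = {}" "N01 \<inter> N00 = {}"
    by (auto simp: N)
  have D: "D = N11 \<union> N10 \<union> N01 \<union> N00"
    using A B pqAB by (auto simp: N D_def)
  have "card D = 5"
    using pq pqAB by (simp add: D_def card_Diff_subset)
  then have c00: "card N00 = 5 - (card N11 + card N10 + card N01)"
    and c5: "card N11 + card N10 + card N01 \<le> 5"
    using D fin disj by (auto simp: card_Un_disjoint Int_Un_distrib2)
  define \<alpha> \<beta> where "\<alpha> = card (A \<inter> {q})" and "\<beta> = card (B \<inter> {p})"
  have "A = N11 \<union> N10 \<union> (A \<inter> {q})" "B = N11 \<union> N01 \<union> (B \<inter> {p})"
    using A B pqAB by (auto simp: N D_def)
  moreover have "card (N11 \<union> N10 \<union> (A \<inter> {q})) = card N11 + card N10 + \<alpha>"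
    using fin disj pqAB by (subst card_Un_disjoint | force simp: N D_def \<alpha>_def)+
  moreover have "card (N11 \<union> N01 \<union> (B \<inter> {p})) = card N11 + card N01 + \<beta>"
    using fin disj pqAB by (subst card_Un_disjoint | force simp: N D_def \<beta>_def)+
  ultimately have cA: "card A = card N11 + card N10 + \<alpha>" and cB: "card B = card N11 + card N01 + \<beta>"
    by auto
  have "\<alpha> \<le> card {q}" "\<beta> \<le> card {p}"
    unfolding \<alpha>_def \<beta>_def by (intro card_mono; simp)+
  then have ab: "\<alpha> < 2" "\<beta> < 2"
    by auto
  have "all_states e (card N11)"
    using all_states_True all_states_False c5 by (cases e) (auto simp: all_below_iff)
  then have "all_splittable e (card N11) (card N10) (card N01) \<beta> a1 b2"
    unfolding a1 b2 cA cB
    by (rule all_statesD)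
      (use c5 ab A(2,3) B(2,3) cc in \<open>simp_all add: cA cB flip: \<alpha>_def \<beta>_def N11_def\<close>)
  then have "splittable e (card N11) (card N10) (card N01) (card N00) \<beta> a1 x y b2 m1 m2"
    unfolding c00 by (rule all_splittableD) (use xy adm in auto)
  then consider
      (in_A) "card N11 \<noteq> 0" "splittable_at e True (card N11 - 1) (card N10) (card N01) (card N00) \<beta> a1 x y b2 m1 m2"
    | (notin_A) "\<not> e" "card N01 \<noteq> 0" "splittable_at e False (card N11) (card N10) (card N01 - 1) (card N00) \<beta> a1 x y b2 m1 m2"
    by (auto simp: splittable_def split: if_splits)
  then obtain w M11 M01 v where w: "w \<in> N11 \<union> N01" "v \<longleftrightarrow> w \<in> A" "M11 = N11 - {w}" "M01 = N01 - {w}" "e \<longrightarrow> w \<in> A"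
    and sp: "splittable_at e v (card M11) (card N10) (card M01) (card N00) \<beta> a1 x y b2 m1 m2"
  proof cases
    case in_A
    then obtain w where "w \<in> N11"
      by fastforce
    then show thesis
      using that[of w True "N11 - {w}" "N01"] in_A disj fin by (auto simp: N)
  next
    case notin_A
    then obtain w where "w \<in> N01"
      by fastforce
    then show thesis
      using that[of w False "N11" "N01 - {w}"] notin_A disj fin by (auto simp: N)
  qed
  obtain X Y where XY: "X \<subseteq> insert p (M11 \<union> N10 \<union> M01 \<union> N00)" "Y \<subseteq> insert p (M11 \<union> N10 \<union> M01 \<union> N00)"
     "X \<inter> Y = {}" "card X = x" "card Y = y" "e \<longrightarrow> p \<notin> X \<and> p \<notin> Y"
     "compatible_counts m1 a1 x (if v \<and> \<not> e then 1 else 0) (card (X \<inter> {p})) (card (X \<inter> (M11 \<union> N10)))"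
     "compatible_counts m2 y b2 0 0 (card (Y \<inter> (M11 \<union> M01)) + card (Y \<inter> {p}) * \<beta>)"
  proof -
    have "finite M11" "finite M01"
      using w(3,4) fin by simp_all
    moreover have "M11 \<inter> N10 = {}" "M11 \<inter> M01 = {}" "M11 \<inter> N00 = {}" "N10 \<inter> M01 = {}" "M01 \<inter> N00 = {}"
      using w(3,4) disj by blast+
    moreover have "p \<notin> M11 \<union> N10 \<union> M01 \<union> N00"
      using w(3,4) pqAB by (simp add: N D_def)
    ultimately show thesis
      using splittable_at_imp_sets[OF sp, of p] fin disj that by metis
  qed
  have wD: "w \<in> B" "w \<noteq> p" "w \<noteq> q" "w < 7"
    using w(1) pqAB B by (auto simp: N D_def)
  have sub: "insert p (M11 \<union> N10 \<union> M01 \<union> N00) \<subseteq> {..<7} - {q, w}"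
    using w(1-4) pq pqAB A B wD by (auto simp: N D_def)
  have XA: "X \<inter> (M11 \<union> N10) = (if e then A - {w} else A) \<inter> X"
    using XY(1) sub w pqAB by (auto simp: N D_def)
  \<comment> \<open>The regions leave out \<open>p\<close>, so a use of \<open>p\<close> in
    \<open>Y\<close> is counted separately; it matters only if \<open>p\<close> is in
    \<open>B\<close>, that is, if \<beta> is 1.\<close>
  have YB: "card (Y \<inter> (M11 \<union> M01)) + card (Y \<inter> {p}) * \<beta> = card (Y \<inter> (B - {w}))"
  proof -
    have fY: "finite Y"
      using XY(2) sub finite_subset[of Y "{..<7}"] by blast
    have "card (Y \<inter> {p}) * \<beta> = card (Y \<inter> B \<inter> {p})"
      by (auto simp: \<beta>_def Int_insert_right)
    moreover have "Y \<inter> (B - {w}) = (Y \<inter> (M11 \<union> M01)) \<union> (Y \<inter> B \<inter> {p})"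
      using XY(2) sub w pqAB by (auto simp: N D_def)
    moreover have "(Y \<inter> (M11 \<union> M01)) \<inter> (Y \<inter> B \<inter> {p}) = {}"
      using w pqAB by (auto simp: N D_def)
    ultimately show ?thesis
      using fY by (simp add: card_Un_disjoint)
  qed
  have cA1: "card (if e then A - {w} else A) = a1"
    using w(5) finAB by (simp add: a1)
  have cB2: "card (B - {w}) = b2"
    using wD finAB by (simp add: b2)
  have wA: "card ((if e then A - {w} else A) \<inter> {w}) = (if v \<and> \<not> e then 1 else 0)"
    using w(2) by auto
  have out: "w \<notin> X" "w \<notin> Y" "q \<notin> X" "q \<notin> Y" "X \<subseteq> {..<7}" "Y \<subseteq> {..<7}"
    using XY(1,2) sub by auto
  have "compatible_state m1 p (if e then A - {w} else A) w X"
    unfolding compatible_state_def cA1 wA XA[symmetric] XY(4) using XY(7) wD(2) pqAB(2) out(1) by simp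
  moreover have "compatible_state m2 w Y q (B - {w})"
    unfolding compatible_state_def cB2 YB[symmetric] XY(5) using XY(8) wD(3) pqAB(3) out(2,4) by simp
  ultimately show ?thesis
    using XY(3-6) wD(1) w(5) out by (intro exI[of _ w] exI[of _ X] exI[of _ Y] conjI) simp_all
qed

subsection \<open>Colouring the square of a noncrossing graph\<close>

text \<open>A graph numbered along a Hamiltonian path. The edge \<open>E 0 n\<close> that closes the
  cycle is only assumed in \<open>square_7_colorable\<close>.\<close>

locale noncrossing_graph =
  fixes n :: nat and E :: "nat \<Rightarrow> nat \<Rightarrow> bool"
  assumes E_sym: "E i j \<Longrightarrow> E j i"
    and E_irrefl: "\<not> E i i"
    and E_Suc: "i < n \<Longrightarrow> E i (Suc i)"
    and noncrossing: "i < j \<Longrightarrow> j < k \<Longrightarrow> k < m \<Longrightarrow> m \<le> n \<Longrightarrow> E i k \<Longrightarrow> \<not> E j m"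
    and degree_le: "i \<le> n \<Longrightarrow> card {j \<in> {..n}. E i j} \<le> 6"
begin

section \<open>States of an interval\<close>

definition nbs :: "nat \<Rightarrow> nat \<Rightarrow> nat \<Rightarrow> nat set" where
  "nbs l r v = {u \<in> {l..r}. E v u}"

definition square_coloring :: "nat \<Rightarrow> nat \<Rightarrow> (nat \<Rightarrow> nat) \<Rightarrow> bool" where
  "square_coloring l r f \<longleftrightarrow> (\<forall>v\<in>{l..r}. f v < 7 \<and> inj_on f (insert v (nbs l r v)))"

text \<open>Each end is left out of the colour set of the other, so the state does not record
  whether \<open>l\<close> and \<open>r\<close> are adjacent.\<close>

definition attains :: "nat \<Rightarrow> nat \<Rightarrow> nat \<Rightarrow> nat set \<Rightarrow> nat \<Rightarrow> nat set \<Rightarrow> bool" where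
  "attains l r p A q B \<longleftrightarrow> (\<exists>f. square_coloring l r f \<and> f l = p \<and> f r = q \<and>
     f ` (nbs l r l - {r}) = A \<and> f ` (nbs l r r - {l}) = B)"

lemma finite_nbs [simp]: "finite (nbs l r v)"
  by (simp add: nbs_def)

lemma nbs_irrefl [simp]: "v \<notin> nbs l r v"
  by (simp add: nbs_def E_irrefl)

lemma card_nbs_le: "v \<le> n \<Longrightarrow> r \<le> n \<Longrightarrow> card (nbs l r v) \<le> 6"
  using card_mono[of "{j \<in> {..n}. E v j}" "nbs l r v"] degree_le[of v] by (force simp: nbs_def)

text \<open>By \<open>sep\<close>, only the edge between \<open>l\<close> and \<open>r\<close> can
  pass over \<open>w\<close>.\<close>

lemma nbs_split_left:
  assumes "l < w" "w < r"
    and sep: "\<And>u t. l \<le> u \<Longrightarrow> u < w \<Longrightarrow> w < t \<Longrightarrow> t \<le> r \<Longrightarrow> E u t \<Longrightarrow> u = l \<and> t = r"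
    and "l \<le> v" "v < w"
  shows "nbs l r v = nbs l w v \<union> (if v = l \<and> E l r then {r} else {})"
proof (rule set_eqI)
  fix u
  show "u \<in> nbs l r v \<longleftrightarrow> u \<in> nbs l w v \<union> (if v = l \<and> E l r then {r} else {})"
    using assms(1,2,4,5) sep[of v u] by (cases "u \<le> w") (auto simp: nbs_def)
qed

lemma nbs_split_right:
  assumes "l < w" "w < r"
    and sep: "\<And>u t. l \<le> u \<Longrightarrow> u < w \<Longrightarrow> w < t \<Longrightarrow> t \<le> r \<Longrightarrow> E u t \<Longrightarrow> u = l \<and> t = r"
    and "w < v" "v \<le> r"
  shows "nbs l r v = nbs w r v \<union> (if v = r \<and> E l r then {l} else {})"
proof (rule set_eqI)
  fix u
  show "u \<in> nbs l r v \<longleftrightarrow> u \<in> nbs w r v \<union> (if v = r \<and> E l r then {l} else {})"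
    using assms(1,2,4,5) sep[of u v] E_sym[of u v] E_sym[of v u] by (cases "w \<le> u") (auto simp: nbs_def)
qed

text \<open>Only \<open>w\<close> has neighbours inside both parts, so the two colourings can be
  merged once the colours on its two sides are disjoint. Apart from that, only a possible edge
  between \<open>l\<close> and \<open>r\<close> adds neighbours, at these two vertices.\<close>

lemma attains_glue:
  assumes lwr: "l < w" "w < r" and Ewr: "E w r"
    and sep: "\<And>u t. l \<le> u \<Longrightarrow> u < w \<Longrightarrow> w < t \<Longrightarrow> t \<le> r \<Longrightarrow> E u t \<Longrightarrow> u = l \<and> t = r"
    and left: "attains l w p (if E l w then A - {c} else A) c X"
    and right: "attains w r c Y q (B - {c})"
    and c: "c \<in> B" "E l w \<longrightarrow> c \<in> A \<and> p \<notin> Y"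
    and pq: "p \<noteq> q" "q \<notin> X" "X \<inter> Y = {}" "E l r \<longrightarrow> q \<notin> A \<and> p \<notin> B"
  shows "attains l r p A q B"
proof -
  obtain f1 where f1: "square_coloring l w f1" "f1 l = p" "f1 w = c"
    "f1 ` (nbs l w l - {w}) = (if E l w then A - {c} else A)" "f1 ` (nbs l w w - {l}) = X"
    using left by (auto simp: attains_def)
  obtain f2 where f2: "square_coloring w r f2" "f2 w = c" "f2 r = q"
    "f2 ` (nbs w r w - {r}) = Y" "f2 ` (nbs w r r - {w}) = B - {c}"
    using right by (auto simp: attains_def)
  define f where "f v = (if v \<le> w then f1 v else f2 v)" for v
  have fl: "f v = f1 v" if "v \<le> w" for v
    using that by (simp add: f_def)
  \<comment> \<open>At \<open>w\<close> itself \<open>f\<close> is defined by \<open>f1\<close>, but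
    both colourings give \<open>w\<close> the colour \<open>c\<close>.\<close>
  have fr: "f v = f2 v" if "w \<le> v" for v
    using that f1(3) f2(2) by (auto simp: f_def)
  have inj1: "inj_on f (insert v (nbs l w v))" if "v \<in> {l..w}" for v
  proof -
    have "inj_on f1 (insert v (nbs l w v))"
      using f1(1) that by (auto simp: square_coloring_def)
    then show ?thesis
      using that by (subst inj_on_cong[of _ f f1]) (auto simp: fl nbs_def)
  qed
  have inj2: "inj_on f (insert v (nbs w r v))" if "v \<in> {w..r}" for v
  proof -
    have "inj_on f2 (insert v (nbs w r v))"
      using f2(1) that by (auto simp: square_coloring_def)
    then show ?thesis
      using that by (subst inj_on_cong[of _ f f2]) (auto simp: fr nbs_def)
  qed
  have im1: "f ` (nbs l w v - T) = f1 ` (nbs l w v - T)" for v T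
    by (rule image_cong) (auto simp: fl nbs_def)
  have im2: "f ` (nbs w r v - T) = f2 ` (nbs w r v - T)" for v T
    by (rule image_cong) (auto simp: fr nbs_def)
  have N1: "nbs l r v = nbs l w v \<union> (if v = l \<and> E l r then {r} else {})" if "l \<le> v" "v < w" for v
    using nbs_split_left[OF lwr sep] that by blast
  have N2: "nbs l r v = nbs w r v \<union> (if v = r \<and> E l r then {l} else {})" if "w < v" "v \<le> r" for v
    using nbs_split_right[OF lwr sep] that by blast
  have nl: "nbs l r l = nbs l w l \<union> (if E l r then {r} else {})"
    using N1[of l] lwr by simp
  have nr: "nbs l r r = nbs w r r \<union> (if E l r then {l} else {})"
    using N2[of r] lwr by simp
  have nw: "nbs l r w = nbs l w w \<union> nbs w r w"
    using lwr by (auto simp: nbs_def)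
  have n1: "nbs l r v = nbs l w v" if "l < v" "v < w" for v
    using N1[of v] that by simp
  have n2: "nbs l r v = nbs w r v" if "w < v" "v < r" for v
    using N2[of v] that by simp
  have fp: "f l = p" "f r = q" "f w = c"
    using fl[of l] fr[of r] fl[of w] f1 f2 lwr by auto
  have A: "f ` nbs l w l = A"
  proof -
    have "nbs l w l = (nbs l w l - {w}) \<union> (if E l w then {w} else {})"
      using lwr by (auto simp: nbs_def)
    from arg_cong[OF this, of "image f"]
    have "f ` nbs l w l = f ` (nbs l w l - {w}) \<union> (if E l w then {c} else {})"
      by (simp only: image_Un if_distrib[of "image f"] image_insert image_empty fp)
    also have "\<dots> = A"
      unfolding im1 f1(4) using c(2) by auto
    finally show ?thesis .
  qed
  have B: "f ` nbs w r r = B"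
  proof -
    have "nbs w r r = insert w (nbs w r r - {w})"
      using lwr Ewr E_sym by (auto simp: nbs_def)
    from arg_cong[OF this, of "image f"]
    have "f ` nbs w r r = insert c (f ` (nbs w r r - {w}))"
      by (simp only: image_insert fp)
    also have "\<dots> = B"
      unfolding im2 f2(5) using c(1) by auto
    finally show ?thesis .
  qed
  have wl: "f ` nbs l w w = X \<union> (if E l w then {p} else {})"
  proof -
    have "nbs l w w = (nbs l w w - {l}) \<union> (if E l w then {l} else {})"
      using lwr E_sym by (auto simp: nbs_def)
    from arg_cong[OF this, of "image f"] show ?thesis
      by (simp only: image_Un if_distrib[of "image f"] image_insert image_empty fp im1 f1(5))
  qed
  have wr: "f ` nbs w r w = insert q Y"
  proof -
    have "nbs w r w = insert r (nbs w r w - {r})"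
      using lwr Ewr by (auto simp: nbs_def)
    from arg_cong[OF this, of "image f"] show ?thesis
      by (simp only: image_insert fp im2 f2(4))
  qed
  have inj: "inj_on f (insert v (nbs l r v))" if v: "v \<in> {l..r}" for v
  proof -
    consider "v = l" | "v = r" | "v = w" | "l < v" "v < w" | "w < v" "v < r"
      using v by fastforce
    then show ?thesis
    proof cases
      case 1
      have "q \<notin> f ` insert l (nbs l w l)" if "E l r"
        using A fp pq that by auto
      then show ?thesis
        using inj1[of l] lwr fp unfolding 1 nl by (auto simp: Un_insert_right)
    next
      case 2
      have "p \<notin> f ` insert r (nbs w r r)" if "E l r"
        using B fp pq that by auto
      then show ?thesis
        using inj2[of r] lwr fp unfolding 2 nr by (auto simp: Un_insert_right)
    next
      case 3
      have "f ` nbs l w w \<inter> f ` nbs w r w = {}"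
        unfolding wl wr using pq c(2) by auto
      then have "inj_on f (insert w (nbs l w w) \<union> insert w (nbs w r w))"
        using inj1[of w] inj2[of w] lwr unfolding inj_on_Un by auto
      moreover have "insert w (nbs l w w \<union> nbs w r w) = insert w (nbs l w w) \<union> insert w (nbs w r w)"
        by auto
      ultimately show ?thesis
        unfolding 3 nw by (simp only:)
    next
      case 4
      then show ?thesis
        using inj1[of v] n1[of v] by simp
    next
      case 5
      then show ?thesis
        using inj2[of v] n2[of v] by simp
    qed
  qed
  have lt: "f v < 7" if "v \<in> {l..r}" for v
    using f1(1) f2(1) that by (auto simp: square_coloring_def f_def)
  have "nbs l r l - {r} = nbs l w l" "nbs l r r - {l} = nbs w r r"
    unfolding nl nr using lwr by (auto simp: nbs_def)
  then have "f ` (nbs l r l - {r}) = A" "f ` (nbs l r r - {l}) = B"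
    using A B by (simp_all only:)
  then show ?thesis
    unfolding attains_def square_coloring_def using fp(1,2) inj lt by blast
qed

text \<open>Induction on \<open>r - l\<close>: the interval is cut at \<open>w\<close>, the finite
  check distributes the colours, and the colourings of the two parts are glued. The flag depends on
  the interval and not only on the counts, hence the existential quantifier.\<close>

lemma interval_colorings:
  assumes "l < r" "r \<le> n" "card (nbs l r l - {r}) \<le> 5" "card (nbs l r r - {l}) \<le> 5"
  shows "\<exists>m. admissible m (card (nbs l r l - {r})) (card (nbs l r r - {l})) \<and>
    (\<forall>p A q B. p < 7 \<and> q < 7 \<and> A \<subseteq> {..<7} \<and> B \<subseteq> {..<7} \<and>
       card A = card (nbs l r l - {r}) \<and> card B = card (nbs l r r - {l}) \<and>
       compatible_state m p A q B \<and> (E l r \<longrightarrow> q \<notin> A \<and> p \<notin> B) \<longrightarrow> attains l r p A q B)"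
  using assms
proof (induction "r - l" arbitrary: l r rule: less_induct)
  case less
  show ?case
  proof (cases "r = Suc l")
    case True
    have lr: "{l..r} = {l, r}"
      using True by auto
    have nb: "nbs l r l - {r} = {}" "nbs l r r - {l} = {}"
      unfolding nbs_def lr using E_irrefl by auto
    have "attains l r p {} q {}" if "p < 7" "q < 7" "p \<noteq> q" for p q
      unfolding attains_def square_coloring_def nb
    proof (intro exI[of _ "\<lambda>v. if v = l then p else q"] conjI ballI)
      fix v assume "v \<in> {l..r}"
      have "insert v (nbs l r v) \<subseteq> {l, r}"
        using \<open>v \<in> {l..r}\<close> unfolding nbs_def lr by auto
      moreover have "inj_on (\<lambda>v. if v = l then p else q) {l, r}"
        using that by (auto simp: inj_on_def)
      ultimately show "inj_on (\<lambda>v. if v = l then p else q) (insert v (nbs l r v))"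
        by (rule inj_on_subset[rotated])
    qed (use that True in auto)
    then have "attains l r p A q B"
      if "p < 7" "q < 7" "p \<noteq> q" "A \<subseteq> {..<7}" "B \<subseteq> {..<7}" "card A = 0" "card B = 0" for p A q B
      using that finite_subset[of A "{..<7}"] finite_subset[of B "{..<7}"] by simp
    then show ?thesis
      unfolding nb by (intro exI[of _ False]) (simp add: admissible_def compatible_state_def)
  next
    case False
    with less.prems have lr: "Suc l < r"
      by auto
    \<comment> \<open>The least interior neighbour of \<open>r\<close>. There is one, because
      \<open>r - 1\<close> is adjacent to \<open>r\<close> and greater than
      \<open>l\<close>.\<close>
    define w where "w = (LEAST w. l < w \<and> w < r \<and> E w r)"
    have "l < r - 1 \<and> r - 1 < r \<and> E (r - 1) r"
      using lr less.prems(2) E_Suc[of "r - 1"] by auto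
    then have w: "l < w" "w < r" "E w r"
      using LeastI[of "\<lambda>w. l < w \<and> w < r \<and> E w r" "r - 1"] by (auto simp: w_def)
    have wmin: "w \<le> u" if "l < u" "u < r" "E u r" for u
      using that Least_le[of "\<lambda>w. l < w \<and> w < r \<and> E w r" u] by (auto simp: w_def)
    \<comment> \<open>An edge over \<open>w\<close> that ends before \<open>r\<close> would cross
      the edge from \<open>w\<close> to \<open>r\<close>; one that ends at \<open>r\<close> starts
      at \<open>l\<close> by minimality of \<open>w\<close>.\<close>
    have sep: "u = l \<and> t = r" if "l \<le> u" "u < w" "w < t" "t \<le> r" "E u t" for u t
      using that noncrossing[of u w t r] w wmin[of u] less.prems(2) by fastforce
    define a where "a = card (nbs l r l - {r})"
    define b where "b = card (nbs l r r - {l})"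
    define a1 where "a1 = card (nbs l w l - {w})"
    define b2 where "b2 = card (nbs w r r - {w})"
    define x where "x = card (nbs l w w - {l})"
    define y where "y = card (nbs w r w - {r})"
    have nl: "nbs l r l - {r} = nbs l w l"
      using nbs_split_left[OF w(1,2) sep, of l] w by (auto simp: nbs_def)
    have nr: "nbs l r r - {l} = nbs w r r"
      using nbs_split_right[OF w(1,2) sep, of r] w by (auto simp: nbs_def)
    have a1: "a1 = a - (if E l w then 1 else 0)"
      using w by (simp add: a1_def a_def nl card_Diff_singleton_if) (auto simp: nbs_def)
    have b2: "b2 = b - 1"
      using w E_sym by (simp add: b2_def b_def nr card_Diff_singleton_if) (auto simp: nbs_def)
    have "Suc l \<in> nbs l w l"
      using w less.prems(2) E_Suc[of l] by (auto simp: nbs_def)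
    then have a: "0 < a" "a \<le> 5"
      using less.prems(3) by (auto simp: a_def nl card_gt_0_iff)
    have "w \<in> nbs w r r"
      using w E_sym by (auto simp: nbs_def)
    then have b: "0 < b" "b \<le> 5"
      using less.prems(4) by (auto simp: b_def nr card_gt_0_iff)
    have xy: "x + y + (if E l w then 1 else 0) \<le> 5"
    proof -
      define L where "L = (if E l w then {l} else {})"
      have "nbs l r w = ((nbs l w w - {l}) \<union> L) \<union> insert r (nbs w r w - {r})"
        using w E_sym by (auto simp: nbs_def L_def)
      also have "card \<dots> = card ((nbs l w w - {l}) \<union> L) + card (insert r (nbs w r w - {r}))"
        using w E_irrefl by (intro card_Un_disjoint) (force simp: nbs_def L_def)+
      also have "card ((nbs l w w - {l}) \<union> L) = x + card L"
        unfolding x_def by (intro card_Un_disjoint) (auto simp: L_def)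
      also have "card (insert r (nbs w r w - {r})) = Suc y"
        unfolding y_def by (subst card_insert_disjoint) auto
      also have "card L = (if E l w then 1 else 0)"
        by (simp add: L_def)
      finally show ?thesis
        using card_nbs_le[of w r l] w less.prems(2) by linarith
    qed
    have le: "w - l < r - l" "r - w < r - l" "w \<le> n" "a1 \<le> 5" "x \<le> 5" "y \<le> 5" "b2 \<le> 5"
      using w less.prems(2) a b a1 b2 xy by auto
    obtain m1 where adm1: "admissible m1 a1 x"
      and left: "\<forall>p A q B. p < 7 \<and> q < 7 \<and> A \<subseteq> {..<7} \<and> B \<subseteq> {..<7} \<and> card A = a1 \<and>
        card B = x \<and> compatible_state m1 p A q B \<and> (E l w \<longrightarrow> q \<notin> A \<and> p \<notin> B) \<longrightarrow> attains l w p A q B"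
      using less.hyps[OF le(1) w(1) le(3)] le(4,5) unfolding a1_def x_def by meson
    obtain m2 where adm2: "admissible m2 y b2"
      and right: "\<forall>p A q B. p < 7 \<and> q < 7 \<and> A \<subseteq> {..<7} \<and> B \<subseteq> {..<7} \<and> card A = y \<and>
        card B = b2 \<and> compatible_state m2 p A q B \<and> (E w r \<longrightarrow> q \<notin> A \<and> p \<notin> B) \<longrightarrow> attains w r p A q B"
      using less.hyps[OF le(2) w(2) less.prems(2)] le(6,7) unfolding y_def b2_def by meson
    show ?thesis
    \<comment> \<open>This is the flag used in \<open>all_states\<close>, with \<open>E l w\<close>
      for \<open>e\<close>.\<close>
    proof (intro exI[of _ "\<not> E l w \<and> a + b \<le> 3"] conjI allI impI)
      show "admissible (\<not> E l w \<and> a + b \<le> 3) (card (nbs l r l - {r})) (card (nbs l r r - {l}))"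
        unfolding a_def[symmetric] b_def[symmetric] using a b by (simp add: admissible_def)
      fix p A q B
      assume "p < 7 \<and> q < 7 \<and> A \<subseteq> {..<7} \<and> B \<subseteq> {..<7} \<and>
       card A = card (nbs l r l - {r}) \<and> card B = card (nbs l r r - {l}) \<and>
       compatible_state (\<not> E l w \<and> a + b \<le> 3) p A q B \<and> (E l r \<longrightarrow> q \<notin> A \<and> p \<notin> B)"
      then have pq: "p < 7" "q < 7" "A \<subseteq> {..<7}" "B \<subseteq> {..<7}" "card A = a" "card B = b"
        and comp: "compatible_state (\<not> E l w \<and> a + b \<le> 3) p A q B" and lr: "E l r \<longrightarrow> q \<notin> A \<and> p \<notin> B"
        by (auto simp: a_def b_def)
      obtain c X Y where c: "X \<subseteq> {..<7}" "Y \<subseteq> {..<7}" "card X = x" "card Y = y"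
        "c \<in> B" "E l w \<longrightarrow> c \<in> A \<and> p \<notin> X \<and> p \<notin> Y" "q \<notin> X" "q \<notin> Y" "X \<inter> Y = {}"
        and comps: "compatible_state m1 p (if E l w then A - {c} else A) c X" "compatible_state m2 c Y q (B - {c})"
      proof -
        have "\<exists>c X Y. X \<subseteq> {..<7} \<and> Y \<subseteq> {..<7} \<and> card X = x \<and> card Y = y \<and>
          c \<in> B \<and> (E l w \<longrightarrow> c \<in> A \<and> p \<notin> X \<and> p \<notin> Y) \<and> q \<notin> X \<and> q \<notin> Y \<and> X \<inter> Y = {} \<and>
          compatible_state m1 p (if E l w then A - {c} else A) c X \<and> compatible_state m2 c Y q (B - {c})"
          by (rule compatible_state_split[OF _ _ _ _ _ _ _ _ _ _ _ xy adm1 adm2])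
            (use pq a b comp a1 b2 in simp_all)
        then show thesis
          by (elim exE conjE) (rule that)
      qed
      have c7: "c < 7"
        using c(5) pq(4) by auto
      have fin: "finite A" "finite B"
        using pq(3,4) finite_subset by blast+
      show "attains l r p A q B"
      proof (rule attains_glue[OF w sep])
        show "attains l w p (if E l w then A - {c} else A) c X"
          by (rule left[rule_format]) (use c comps pq fin c7 in \<open>auto simp: a1\<close>)
        show "attains w r c Y q (B - {c})"
          by (rule right[rule_format]) (use c comps pq fin c7 in \<open>auto simp: b2\<close>)
        show "p \<noteq> q"
          using comp by (simp add: compatible_state_def)
      qed (use c lr in auto)
    qed
  qed
qed

text \<open>One compatible state of the whole interval suffices. The ends get the colours 5 and 6,
  and \<open>A\<close> and \<open>B\<close> are chosen below 5, so the condition imposed by the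
  closing edge holds automatically.\<close>

lemma square_7_colorable:
  assumes "0 < n" "E 0 n"
  shows "\<exists>f. square_coloring 0 n f"
proof -
  define a where "a = card (nbs 0 n 0 - {n})"
  define b where "b = card (nbs 0 n n - {0})"
  have "n \<in> nbs 0 n 0" "0 \<in> nbs 0 n n"
    using assms E_sym by (auto simp: nbs_def)
  then have ab: "a \<le> 5" "b \<le> 5"
    using card_nbs_le[of 0 n 0] card_nbs_le[of n n 0] by (auto simp: a_def b_def)
  obtain m where adm: "admissible m a b"
    and att: "\<forall>p A q B. p < 7 \<and> q < 7 \<and> A \<subseteq> {..<7} \<and> B \<subseteq> {..<7} \<and> card A = a \<and>
        card B = b \<and> compatible_state m p A q B \<and> (E 0 n \<longrightarrow> q \<notin> A \<and> p \<notin> B) \<longrightarrow> attains 0 n p A q B"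
    using interval_colorings[OF assms(1) order_refl ab[unfolded a_def b_def]]
    unfolding a_def b_def by meson
  have "\<exists>A B. A \<subseteq> {..<5::nat} \<and> B \<subseteq> {..<5} \<and> card A = a \<and> card B = b \<and> compatible_counts m a b 0 0 (card (A \<inter> B))"
  proof -
    \<comment> \<open>With the flag, \<open>A\<close> and \<open>B\<close> must be disjoint. For two
      sets of size 2 they must share exactly one colour. Otherwise nested initial segments
      work.\<close>
    consider "m" | "\<not> m" "a = 2" "b = 2" | "\<not> m" "\<not> (a = 2 \<and> b = 2)"
      by blast
    then show ?thesis
    proof cases
      case 1
      with adm show ?thesis
        by (intro exI[of _ "{..<a}"] exI[of _ "{a..<a + b}"])
          (auto simp: admissible_def compatible_counts_def)
    next
      case 2
      then show ?thesis
        by (intro exI[of _ "{0, 1}"] exI[of _ "{1, 2}"]) (auto simp: compatible_counts_def)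
    next
      case 3
      have c: "card ({..<a} \<inter> {..<b}) = min a b"
        by (metis Int_absorb1 Int_absorb2 card_lessThan lessThan_subset_iff min_def nat_le_linear)
      have "compatible_counts m a b 0 0 (min a b)"
        using 3 adm by (auto simp: admissible_def compatible_counts_def)
      then show ?thesis
        using ab by (intro exI[of _ "{..<a}"] exI[of _ "{..<b}"]) (simp add: c)
    qed
  qed
  then obtain A B :: "nat set" where AB: "A \<subseteq> {..<5}" "B \<subseteq> {..<5}" "card A = a" "card B = b"
    "compatible_counts m a b 0 0 (card (A \<inter> B))"
    by blast
  then have "6 \<notin> A" "5 \<notin> A" "6 \<notin> B" "5 \<notin> B"
    by auto
  then have "attains 0 n 5 A 6 B"
    using AB by (intro att[rule_format]) (auto simp: compatible_state_def)
  then show ?thesis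
    by (auto simp: attains_def)
qed

end

subsection \<open>The square of a biconnected outerplanar graph\<close>

text \<open>The distance is an infimum of walk lengths. If it is below 3, some walk has length at
  most 2; conversely a short walk bounds it from above, and \<open>len1\<close> and
  \<open>len2\<close> bound it from below.\<close>

lemma graph_dist_le_2_iff:
  assumes "pair_wf_digraph G" "u \<in> pverts G" "u \<noteq> v"
  shows "graph_dist G u v = 1 \<or> graph_dist G u v = 2 \<longleftrightarrow> adj G u v \<or> (\<exists>w. adj G u w \<and> adj G w v)"
proof -
  interpret pair_wf_digraph G by fact
  have dist: "graph_dist G u v = (INF p\<in>{p. awalk u p v}. ereal (real (length p)))"
    by (simp add: graph_dist_def \<mu>_def awalk_cost_def sum_list_triv)
  have len1: "1 \<le> length p" if "awalk u p v" for p
    using that assms(3) by (cases p) (auto simp: awalk_Nil_iff)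
  have len2: "2 \<le> length p" if "awalk u p v" "\<not> adj G u v" for p
  proof (cases p)
    case Nil
    then show ?thesis
      using that assms(3) by (auto simp: awalk_Nil_iff)
  next
    case (Cons e p')
    then show ?thesis
      using that by (cases p') (auto simp: awalk_Cons_iff awalk_Nil_iff)
  qed
  show ?thesis
  proof
    assume "graph_dist G u v = 1 \<or> graph_dist G u v = 2"
    then have "graph_dist G u v < 3"
      by auto
    then obtain p where p: "awalk u p v" "length p < 3"
      unfolding dist INF_less_iff by auto
    then show "adj G u v \<or> (\<exists>w. adj G u w \<and> adj G w v)"
      using len1[OF p(1)] by (cases p; cases "tl p"; cases "tl (tl p)")
        (auto simp: awalk_Cons_iff awalk_Nil_iff)
  next
    assume "adj G u v \<or> (\<exists>w. adj G u w \<and> adj G w v)"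
    then consider "adj G u v" | w where "\<not> adj G u v" "adj G u w" "adj G w v"
      by blast
    then show "graph_dist G u v = 1 \<or> graph_dist G u v = 2"
    proof cases
      case 1
      then have "awalk u [(u, v)] v"
        using in_arcsD2 assms(2) by (auto simp: awalk_Cons_iff awalk_Nil_iff)
      then have "graph_dist G u v \<le> ereal (real (length [(u, v)]))"
        unfolding dist by (intro INF_lower) auto
      moreover have "1 \<le> graph_dist G u v"
        unfolding dist using len1 by (intro INF_greatest) auto
      ultimately show ?thesis
        by (auto simp: one_ereal_def)
    next
      case 2
      then have "awalk u [(u, w), (w, v)] v"
        using in_arcsD2 assms(2) by (auto simp: awalk_Cons_iff awalk_Nil_iff)
      then have "graph_dist G u v \<le> ereal (real (length [(u, w), (w, v)]))"
        unfolding dist by (intro INF_lower) auto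
      moreover have "2 \<le> graph_dist G u v"
        unfolding dist using len2 2(1) by (intro INF_greatest) auto
      ultimately show ?thesis
        by auto
    qed
  qed
qed

text \<open>Connectedness of a digraph is reachability in the symmetric closure of its arcs, so
  \<open>R\<close> has to hold in both directions.\<close>

lemma connected_imp_rtranclp:
  assumes "Digraph_Component.connected H" "u \<in> verts H" "v \<in> verts H"
    and R: "\<And>x y. (x, y) \<in> arcs_ends H \<Longrightarrow> R x y \<and> R y x"
  shows "R\<^sup>*\<^sup>* u v"
proof -
  have "(u, v) \<in> rtrancl_on (verts H) ((arcs_ends H)\<^sup>s)"
    using assms(1-3) by (auto simp: connected_conv)
  then have "(u, v) \<in> ((arcs_ends H)\<^sup>s)\<^sup>*"
    using rtrancl_on_sub_rtrancl by blast
  then show ?thesis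
  proof (induction rule: rtrancl_induct)
    case (step y z)
    then have "R y z"
      using R by (auto simp: symcl_def)
    with step.IH show ?case
      by (rule rtranclp.rtrancl_into_rtrancl)
  qed simp
qed

lemma out_degree_eq_card: "out_degree (with_proj G) v = card {u. adj G v u}"
proof -
  have "out_arcs (with_proj G) v = Pair v ` {u. adj G v u}"
    by (auto simp: out_arcs_def)
  then show ?thesis
    by (simp add: out_degree_def card_image inj_on_def)
qed

text \<open>Two vertices at distance 1 or 2 lie in a common closed neighbourhood: that of one of
  them, or of a vertex between them.\<close>

lemma proper_coloring_squareI:
  assumes "pair_graph G" and "\<And>v. v \<in> pverts G \<Longrightarrow> c v < k"
    and "\<And>v. v \<in> pverts G \<Longrightarrow> inj_on c (insert v {u. adj G v u})"
  shows "proper_coloring (graph_square G) k c"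
proof -
  interpret pair_graph G by fact
  have symG: "adj G v u" if "adj G u v" for u v
    using that pair_sym_arcs by (auto simp: symmetric_def sym_def)
  have "c u \<noteq> c v" if "(u, v) \<in> parcs (graph_square G)" for u v
  proof -
    have uv: "u \<in> pverts G" "v \<in> pverts G" "u \<noteq> v" "graph_dist G u v = 1 \<or> graph_dist G u v = 2"
      using that by (auto simp: graph_square_def)
    then consider "adj G u v" | w where "adj G u w" "adj G w v"
      using graph_dist_le_2_iff[of G u v] pair_wf_digraph_axioms by auto
    then show ?thesis
    proof cases
      case 1
      then show ?thesis
        using assms(3)[OF uv(1)] uv(3) by (auto simp: inj_on_def)
    next
      case 2
      then have "w \<in> pverts G" "u \<in> insert w {x. adj G w x}" "v \<in> insert w {x. adj G w x}"
        using in_arcsD2 symG by auto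
      then show ?thesis
        using assms(3)[of w] uv(3) by (meson inj_onD)
    qed
  qed
  then show ?thesis
    using assms(2) by (auto simp: proper_coloring_def graph_square_def)
qed

lemma proper_coloring_square_inj_on:
  assumes "pair_graph G" and "proper_coloring (graph_square G) k c" and "v \<in> pverts G"
  shows "inj_on c (insert v {u. adj G v u})"
proof -
  interpret pair_graph G by fact
  have symG: "adj G v u" if "adj G u v" for u v
    using that pair_sym_arcs by (auto simp: symmetric_def sym_def)
  show ?thesis
  proof (rule inj_onI, rule ccontr)
    fix x y
    assume xy: "x \<in> insert v {u. adj G v u}" "y \<in> insert v {u. adj G v u}" "c x = c y" "x \<noteq> y"
    then have "x \<in> pverts G" "y \<in> pverts G" "adj G x y \<or> (\<exists>w. adj G x w \<and> adj G w y)"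
      using assms(3) in_arcsD2 symG by auto
    then have "(x, y) \<in> parcs (graph_square G)"
      using graph_dist_le_2_iff[of G x y] pair_wf_digraph_axioms xy(4) by (auto simp: graph_square_def)
    then show False
      using assms(2) xy(3) by (auto simp: proper_coloring_def)
  qed
qed

theorem theorem6p8:
  fixes G :: "'a pair_pre_digraph"
  assumes "pair_graph G"
    and "biconnected G"
    and "outerplanar G"
    and "max_degree G = 6"
  shows "chromatic_number (graph_square G) = 7"
proof -
  interpret pair_graph G by fact
  have symG: "adj G v u" if "adj G u v" for u v
    using that pair_sym_arcs by (auto simp: symmetric_def sym_def)
  then have symp: "symp (adj G)"
    by (auto simp: symp_def)
  have irrefl: "\<not> adj G v v" for v
    using pair_no_loops[of "(v, v)"] by auto
  have wfG: "pair_wf_digraph G"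
    by unfold_locales
  have nbs_sub: "{u. adj G v u} \<subseteq> pverts G" for v
    using in_arcsD2 by auto
  then have fin_nbs: "finite {u. adj G v u}" for v
    using pair_finite_verts finite_subset by blast
  have conn: "(adj G)\<^sup>*\<^sup>* u v" if "u \<in> pverts G" "v \<in> pverts G" for u v
    using assms(2) that symG unfolding biconnected_def
    by (intro connected_imp_rtranclp[of "with_proj G"]) auto
  have biconn: "(\<lambda>x y. adj G x y \<and> x \<noteq> a \<and> y \<noteq> a)\<^sup>*\<^sup>* u v"
    if "a \<in> pverts G" "u \<in> pverts G - {a}" "v \<in> pverts G - {a}" for a u v
  proof (rule connected_imp_rtranclp[of "pre_digraph.del_vert (with_proj G) a"])
    show "Digraph_Component.connected (pre_digraph.del_vert (with_proj G) a)"
      using assms(2) that by (auto simp: biconnected_def)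
  qed (use that symG in \<open>auto simp: del_vert_simps arcs_ends_conv\<close>)
  have theta: "theta_free (adj G)"
    using wfG assms(3) by (rule outerplanar_theta_free)
  have V: "pverts G \<noteq> {}" "finite (out_degree (with_proj G) ` pverts G)"
    using assms(2) pair_finite_verts by (auto simp: biconnected_def connected_conv)
  have deg_le: "card {u. adj G v u} \<le> 6" if "v \<in> pverts G" for v
    using Max_ge[OF V(2) imageI[OF that]] assms(4)
    by (simp only: max_degree_def out_degree_eq_card)
  obtain z where z: "z \<in> pverts G" "card {u. adj G z u} = 6"
  proof -
    have "6 \<in> out_degree (with_proj G) ` pverts G"
      using Max_in[OF V(2)] V(1) assms(4) unfolding max_degree_def by (metis image_is_empty)
    then show thesis
      using that by (auto simp: out_degree_eq_card)
  qed
  obtain z1 z2 where "adj G z z1" "adj G z z2" "z1 \<noteq> z2"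
  proof -
    have "\<not> {u. adj G z u} \<subseteq> {x}" for x
      using card_mono[of "{x}" "{u. adj G z u}"] z(2) by auto
    then show thesis
      using that by (metis mem_Collect_eq singletonI subsetI)
  qed
  from exists_spanning_cycle[of "adj G" "pverts G", OF symp pair_finite_verts _ irrefl conn biconn theta this]
  obtain xs where xs: "vertex_cycle (adj G) xs" "set xs = pverts G"
    using in_arcsD1 in_arcsD2 by blast
  have dist: "distinct xs" "xs \<noteq> []"
    using xs by (auto simp: vertex_cycle_def)
  \<comment> \<open>A vertex of degree 6 and its neighbours make seven vertices, which excludes the
    complete graph on four vertices in \<open>noncrossing_cycle\<close>.\<close>
  have len: "7 \<le> length xs"
  proof -
    have "card (insert z {u. adj G z u}) \<le> card (set xs)"
      using z(1) nbs_sub xs(2) by (intro card_mono) auto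
    then show ?thesis
      using z(2) fin_nbs irrefl distinct_card[OF dist(1)] by simp
  qed
  define n where "n = length xs - 1"
  \<comment> \<open>The graph on positions of the cycle. The bounds are explicit because
    \<open>xs ! i\<close> is unspecified beyond the end of the list.\<close>
  define E where "E i j \<longleftrightarrow> i \<le> n \<and> j \<le> n \<and> adj G (xs ! i) (xs ! j)" for i j
  have n: "i \<le> n \<longleftrightarrow> i < length xs" for i
    using len by (auto simp: n_def)
  have nbs_eq: "{u. adj G (xs ! i) u} = (!) xs ` {j \<in> {..n}. E i j}" if "i \<le> n" for i
  proof -
    have "u \<in> (!) xs ` {j \<in> {..n}. E i j}" if "adj G (xs ! i) u" for u
    proof -
      have "u \<in> set xs"
        using that in_arcsD2 xs(2) by auto
      then obtain j where "j < length xs" "u = xs ! j"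
        by (auto simp: in_set_conv_nth)
      then show ?thesis
        using that \<open>i \<le> n\<close> n by (auto simp: E_def)
    qed
    then show ?thesis
      by (auto simp: E_def)
  qed
  have inj_nth: "inj_on ((!) xs) {..n}"
    using dist(1) n by (auto simp: inj_on_def nth_eq_iff_index_eq)
  interpret noncrossing_graph n E
  proof
    show "E j i" if "E i j" for i j
      using that symG by (auto simp: E_def)
    show "\<not> E i i" for i
      using irrefl by (auto simp: E_def)
    show "E i (Suc i)" if "i < n" for i
      using that xs(1) n[of "Suc i"] by (auto simp: E_def vertex_cycle_def successively_conv_nth)
    show "\<not> E j m" if "i < j" "j < k" "k < m" "m \<le> n" "E i k" for i j k m
      using noncrossing_cycle[OF symp theta xs(1) _ that(1-3)] that(4,5) len n
      by (auto simp: E_def)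
    show "card {j \<in> {..n}. E i j} \<le> 6" if "i \<le> n" for i
    proof -
      have "card {j \<in> {..n}. E i j} = card {u. adj G (xs ! i) u}"
        unfolding nbs_eq[OF that] by (intro card_image[symmetric] inj_on_subset[OF inj_nth]) auto
      then show ?thesis
        using deg_le[of "xs ! i"] that n xs(2) by (metis nth_mem)
    qed
  qed
  have "0 < n"
    using len by (simp add: n_def)
  moreover have "adj G (hd xs) (last xs)"
    using xs(1) symG by (simp add: vertex_cycle_def)
  then have "E 0 n"
    using dist(2) by (simp add: E_def n_def hd_conv_nth last_conv_nth)
  ultimately obtain f where f: "square_coloring 0 n f"
    using square_7_colorable by blast
  \<comment> \<open>The colouring of positions is carried over to the vertices.\<close>
  define c where "c v = f (the_inv_into {..n} ((!) xs) v)" for v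
  have c_nth: "c (xs ! i) = f i" if "i \<le> n" for i
    using the_inv_into_f_f[OF inj_nth] that by (simp add: c_def)
  have "proper_coloring (graph_square G) 7 c"
  proof (rule proper_coloring_squareI[OF assms(1)])
    fix v assume "v \<in> pverts G"
    then obtain i where i: "i \<le> n" "v = xs ! i"
      using xs(2) n by (metis in_set_conv_nth)
    show "c v < 7"
      using f i by (simp add: c_nth square_coloring_def)
    define S where "S = insert i {j \<in> {..n}. E i j}"
    have "inj_on f S"
      using f i(1) by (simp add: S_def square_coloring_def nbs_def atLeast0AtMost)
    moreover have "(c \<circ> (!) xs) j = f j" if "j \<in> S" for j
      using that i(1) c_nth[of j] by (auto simp: S_def)
    ultimately have "inj_on (c \<circ> (!) xs) S"
      by (simp cong: inj_on_cong)
    then have "inj_on c ((!) xs ` S)"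
      by (rule inj_on_imageI)
    moreover have "(!) xs ` S = insert v {u. adj G v u}"
      unfolding i(2) nbs_eq[OF i(1)] by (simp add: S_def)
    ultimately show "inj_on c (insert v {u. adj G v u})"
      by (simp only:)
  qed
  \<comment> \<open>For the lower bound, the vertex \<open>z\<close> of degree 6 and its neighbours
    are pairwise at distance at most 2 and need seven colours.\<close>
  moreover have "7 \<le> k" if "proper_coloring (graph_square G) k c'" for k c'
  proof -
    have "card (c' ` insert z {u. adj G z u}) = 7"
      using proper_coloring_square_inj_on[OF assms(1) that z(1)] z(2) fin_nbs irrefl
      by (simp add: card_image)
    moreover have "c' ` insert z {u. adj G z u} \<subseteq> {..<k}"
      using that z(1) nbs_sub by (auto simp: proper_coloring_def graph_square_def)
    ultimately show ?thesis
      by (metis card_lessThan card_mono finite_lessThan)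
  qed
  ultimately show ?thesis
    unfolding chromatic_number_def by (intro Least_equality) auto
qed

end
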